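(* Let $c\ge 3$ be an integer. Given a connected vertex-weighted $K_{1,c}$-free graph $G=(V,E,w)$ with $w:V\to\mathbb{N}$ and an integer $k\in\mathbb{N}$, a $(c-1)$-approximation for \textsc{Min-Max BCP} on $(G,k)$ can be computed in $\mathcal{O}(|E|)$ time.
   Context: $\mathbb{N}$ denotes the positive integers. All graphs are simple, finite and connected. A graph is $K_{1,c}$-free ($c$-claw-free) if it has no induced subgraph isomorphic to the star $K_{1,c}$ (one center and $c$ leaves). For $U\subseteq V$, $w(U)=\sum_{u\in U}w(u)$. A connected $k$-partition of $G$ is a partition $T_1,\dots,T_k$ of $V$ such that each $G[T_i]$ is connected. \textsc{Min-Max BCP}: given $(G,k)$, find a connected $k$-partition minimizing $\max_{i\in[k]} w(T_i)$; letting $X^*$ be the optimum value, a $(c-1)$-approximation is a connected partition (into at most $k$ parts) whose heaviest part has weight at most $(c-1)X^*$. *)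

theory Defs
  imports Complex_Main "HOL-Library.Landau_Symbols" "HOL-Library.Disjoint_Sets"
begin

section \<open>Graphs\<close>

record 'a graph =
  verts :: "'a set"
  edges :: "'a set set"

definition simple_graph :: "'a graph \<Rightarrow> bool" where
  "simple_graph G \<longleftrightarrow> finite (verts G) \<and> (\<forall>e\<in>edges G. e \<subseteq> verts G \<and> card e = 2)"

definition induced :: "'a graph \<Rightarrow> 'a set \<Rightarrow> 'a graph" where
  "induced G U = \<lparr>verts = verts G \<inter> U, edges = {e \<in> edges G. e \<subseteq> U}\<rparr>"

definition adjacency :: "'a graph \<Rightarrow> 'a rel" where
  "adjacency G = {(u, v). {u, v} \<in> edges G}"

text \<open>The graph without vertices does not count as connected.\<close>

definition connected_graph :: "'a graph \<Rightarrow> bool" where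
  "connected_graph G \<longleftrightarrow>
     verts G \<noteq> {} \<and> (\<forall>u\<in>verts G. \<forall>v\<in>verts G. (u, v) \<in> (adjacency G)\<^sup>*)"

definition isomorphic :: "'a graph \<Rightarrow> 'b graph \<Rightarrow> bool" where
  "isomorphic G H \<longleftrightarrow> (\<exists>f. bij_betw f (verts G) (verts H) \<and>
     (\<forall>u\<in>verts G. \<forall>v\<in>verts G. {u, v} \<in> edges G \<longleftrightarrow> {f u, f v} \<in> edges H))"

text \<open>The star with centre \<open>0\<close> and leaves \<open>1, \<dots>, c\<close>.\<close>

definition star :: "nat \<Rightarrow> nat graph" where
  "star c = \<lparr>verts = {0..c}, edges = {{0, i} | i. i \<in> {1..c}}\<rparr>"

definition claw_free :: "nat \<Rightarrow> 'a graph \<Rightarrow> bool" where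
  "claw_free c G \<longleftrightarrow> \<not> (\<exists>U\<subseteq>verts G. isomorphic (induced G U) (star c))"


section \<open>Min-Max balanced connected partition\<close>

definition connected_partition :: "'a graph \<Rightarrow> 'a set set \<Rightarrow> bool" where
  "connected_partition G P \<longleftrightarrow>
     partition_on (verts G) P \<and> (\<forall>T\<in>P. connected_graph (induced G T))"

definition connected_k_partition :: "'a graph \<Rightarrow> nat \<Rightarrow> 'a set set \<Rightarrow> bool" where
  "connected_k_partition G k P \<longleftrightarrow> connected_partition G P \<and> card P = k"

definition heaviest :: "('a \<Rightarrow> nat) \<Rightarrow> 'a set set \<Rightarrow> nat" where
  "heaviest w P = Max (sum w ` P)"

text \<open>
  Parts are nonempty, so no connected \<open>k\<close>-partition, and hence no optimum value,
  exists if \<open>k\<close> exceeds the number of vertices. The optimum value is therefore a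
  predicate, true of at most one number.
\<close>

definition min_max_bcp_optimum :: "'a graph \<Rightarrow> ('a \<Rightarrow> nat) \<Rightarrow> nat \<Rightarrow> nat \<Rightarrow> bool" where
  "min_max_bcp_optimum G w k X \<longleftrightarrow>
     (\<exists>P. connected_k_partition G k P \<and> heaviest w P = X) \<and>
     (\<forall>P. connected_k_partition G k P \<longrightarrow> X \<le> heaviest w P)"

definition min_max_bcp_approximation ::
    "nat \<Rightarrow> 'a graph \<Rightarrow> ('a \<Rightarrow> nat) \<Rightarrow> nat \<Rightarrow> 'a set set \<Rightarrow> bool" where
  "min_max_bcp_approximation r G w k P \<longleftrightarrow>
     connected_partition G P \<and> card P \<le> k \<and>
     (\<forall>X. min_max_bcp_optimum G w k X \<longrightarrow> heaviest w P \<le> r * X)"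


section \<open>Word RAM programs\<close>

text \<open>
  Running time is measured on a word RAM, programmed in a structured language with
  scalar variables and arrays. A program mentions finitely many of them, so its
  arrays interleave into a single memory with constant overhead. Memory is total and
  cells that do not hold input start as \<open>0\<close>. Every operation, comparison and memory
  access has unit cost.

  The semantics carries a bound \<open>B\<close>, the number of values a machine word can take. All
  values that occur, including intermediate results and array indices, must stay
  below it; a program that would overflow has no execution. This prevents unit-cost
  multiplication from packing unbounded amounts of data into one number.
\<close>

type_synonym vname = string

record state =
  vars :: "vname \<Rightarrow> nat"
  arrs :: "vname \<Rightarrow> nat \<Rightarrow> nat"

datatype aexp =
    Const nat
  | Var vname
  | Get vname aexp
  | Add aexp aexp
  | Sub aexp aexp
  | Mul aexp aexp
  | Div aexp aexp

datatype bexp =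
    Less aexp aexp
  | Equal aexp aexp
  | Not bexp
  | And bexp bexp

datatype com =
    Skip
  | Assign vname aexp
  | Put vname aexp aexp
  | Seq com com
  | If bexp com com
  | While bexp com

text \<open>\<open>Sub\<close> is truncated subtraction, and division by zero yields zero.\<close>

fun aval :: "aexp \<Rightarrow> state \<Rightarrow> nat" where
  "aval (Const n) s = n"
| "aval (Var x) s = vars s x"
| "aval (Get a e) s = arrs s a (aval e s)"
| "aval (Add e f) s = aval e s + aval f s"
| "aval (Sub e f) s = aval e s - aval f s"
| "aval (Mul e f) s = aval e s * aval f s"
| "aval (Div e f) s = aval e s div aval f s"

fun bval :: "bexp \<Rightarrow> state \<Rightarrow> bool" where
  "bval (Less e f) s \<longleftrightarrow> aval e s < aval f s"
| "bval (Equal e f) s \<longleftrightarrow> aval e s = aval f s"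
| "bval (Not b) s \<longleftrightarrow> \<not> bval b s"
| "bval (And b d) s \<longleftrightarrow> bval b s \<and> bval d s"

fun afits :: "nat \<Rightarrow> aexp \<Rightarrow> state \<Rightarrow> bool" where
  "afits B (Const n) s \<longleftrightarrow> n < B"
| "afits B (Var x) s \<longleftrightarrow> vars s x < B"
| "afits B (Get a e) s \<longleftrightarrow> afits B e s \<and> aval (Get a e) s < B"
| "afits B (Add e f) s \<longleftrightarrow> afits B e s \<and> afits B f s \<and> aval (Add e f) s < B"
| "afits B (Sub e f) s \<longleftrightarrow> afits B e s \<and> afits B f s \<and> aval (Sub e f) s < B"
| "afits B (Mul e f) s \<longleftrightarrow> afits B e s \<and> afits B f s \<and> aval (Mul e f) s < B"
| "afits B (Div e f) s \<longleftrightarrow> afits B e s \<and> afits B f s \<and> aval (Div e f) s < B"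

fun bfits :: "nat \<Rightarrow> bexp \<Rightarrow> state \<Rightarrow> bool" where
  "bfits B (Less e f) s \<longleftrightarrow> afits B e s \<and> afits B f s"
| "bfits B (Equal e f) s \<longleftrightarrow> afits B e s \<and> afits B f s"
| "bfits B (Not b) s \<longleftrightarrow> bfits B b s"
| "bfits B (And b d) s \<longleftrightarrow> bfits B b s \<and> bfits B d s"

fun acost :: "aexp \<Rightarrow> nat" where
  "acost (Const n) = 1"
| "acost (Var x) = 1"
| "acost (Get a e) = 1 + acost e"
| "acost (Add e f) = 1 + acost e + acost f"
| "acost (Sub e f) = 1 + acost e + acost f"
| "acost (Mul e f) = 1 + acost e + acost f"
| "acost (Div e f) = 1 + acost e + acost f"

fun bcost :: "bexp \<Rightarrow> nat" where
  "bcost (Less e f) = 1 + acost e + acost f"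
| "bcost (Equal e f) = 1 + acost e + acost f"
| "bcost (Not b) = 1 + bcost b"
| "bcost (And b d) = 1 + bcost b + bcost d"

text \<open>\<open>exec B p s t s'\<close>: with word bound \<open>B\<close>, program \<open>p\<close> started in state \<open>s\<close>
  terminates in state \<open>s'\<close> after \<open>t\<close> steps.\<close>

inductive exec :: "nat \<Rightarrow> com \<Rightarrow> state \<Rightarrow> nat \<Rightarrow> state \<Rightarrow> bool" for B :: nat where
  Skip: "exec B Skip s 1 s"
| Assign: "afits B e s \<Longrightarrow>
    exec B (Assign x e) s (1 + acost e) (s\<lparr>vars := (vars s)(x := aval e s)\<rparr>)"
| Put: "afits B i s \<Longrightarrow> afits B e s \<Longrightarrow>
    exec B (Put a i e) s (1 + acost i + acost e)
      (s\<lparr>arrs := (arrs s)(a := (arrs s a)(aval i s := aval e s))\<rparr>)"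
| Seq: "exec B p s t s' \<Longrightarrow> exec B q s' t' s'' \<Longrightarrow> exec B (Seq p q) s (1 + t + t') s''"
| IfTrue: "bfits B b s \<Longrightarrow> bval b s \<Longrightarrow> exec B p s t s' \<Longrightarrow>
    exec B (If b p q) s (1 + bcost b + t) s'"
| IfFalse: "bfits B b s \<Longrightarrow> \<not> bval b s \<Longrightarrow> exec B q s t s' \<Longrightarrow>
    exec B (If b p q) s (1 + bcost b + t) s'"
| WhileFalse: "bfits B b s \<Longrightarrow> \<not> bval b s \<Longrightarrow> exec B (While b p) s (1 + bcost b) s"
| WhileTrue: "bfits B b s \<Longrightarrow> bval b s \<Longrightarrow> exec B p s t s' \<Longrightarrow>
    exec B (While b p) s' t' s'' \<Longrightarrow> exec B (While b p) s (1 + bcost b + t + t') s''"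


section \<open>Input and output\<close>

definition adjacency_lists :: "'a graph \<Rightarrow> ('a \<Rightarrow> 'a list) \<Rightarrow> bool" where
  "adjacency_lists G nbrs \<longleftrightarrow>
     (\<forall>v\<in>verts G. distinct (nbrs v) \<and> set (nbrs v) = {u. {u, v} \<in> edges G})"

definition array_of :: "nat list \<Rightarrow> nat \<Rightarrow> nat" where
  "array_of xs i = (if i < length xs then xs ! i else 0)"

text \<open>
  An instance has vertices \<open>0, \<dots>, n - 1\<close>. The adjacency lists are stored one after the
  other in \<open>adj\<close>; the list of \<open>v\<close> occupies the positions from \<open>off[v]\<close> up to, but
  excluding, \<open>off[v + 1]\<close>.
\<close>

definition input_state :: "nat \<Rightarrow> (nat \<Rightarrow> nat list) \<Rightarrow> (nat \<Rightarrow> nat) \<Rightarrow> nat \<Rightarrow> state" where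
  "input_state n nbrs w k =
     \<lparr>vars = (\<lambda>_. 0)(''n'' := n, ''k'' := k),
      arrs = (\<lambda>_ _. 0)
        (''off'' := array_of (map (\<lambda>v. \<Sum>u<v. length (nbrs u)) [0..<Suc n]),
         ''adj'' := array_of (concat (map nbrs [0..<n])),
         ''weight'' := array_of (map w [0..<n]))\<rparr>"

text \<open>Vertices belong to the same part iff they have the same label in \<open>part\<close>.\<close>

definition output_partition :: "nat \<Rightarrow> state \<Rightarrow> nat set set" where
  "output_partition n s = (\<lambda>v. {u. u < n \<and> arrs s ''part'' u = arrs s ''part'' v}) ` {..<n}"

text \<open>
  A bound on the size of the instance and on all numbers in it. Machine words have
  length logarithmic in this quantity, so the word bound is one of its powers.
\<close>

definition magnitude :: "'a graph \<Rightarrow> ('a \<Rightarrow> nat) \<Rightarrow> nat \<Rightarrow> nat" where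
  "magnitude G w k = 2 + card (verts G) + card (edges G) + sum w (verts G) + k"

end

theory Submission
  imports Defs
begin

text \<open>
  The optimum is at least \<open>\<lambda> = max (max w) \<lceil>w(V) / k\<rceil>\<close>, so it suffices to split the graph into
  connected parts of weight at most \<open>(c - 1)\<lambda>\<close> of which all but one weigh at least \<open>\<lambda>\<close>: there are
  then at most \<open>k\<close> of them. Take a depth-first search tree. No edge joins the subtrees of two
  children of a vertex, so a vertex has fewer than \<open>c\<close> children. Process the vertices bottom-up; a
  vertex \<open>v\<close> collects the bags of its children, each lighter than \<open>\<lambda>\<close>. If the bag of \<open>v\<close> is still
  lighter than \<open>\<lambda>\<close>, it is passed to the parent; if its weight is between \<open>\<lambda>\<close> and \<open>(c - 1)\<lambda>\<close>, it
  becomes a part. If it is heavier, then \<open>v\<close> has exactly \<open>c - 1\<close> children, and the parent of \<open>v\<close> is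
  adjacent to some child \<open>u\<close>, as otherwise the parent and the children would be the leaves of a claw
  centred at \<open>v\<close>. The bag of \<open>v\<close> without that of \<open>u\<close> becomes a part, and \<open>u\<close> is hung below the
  parent of \<open>v\<close> instead, which preserves the absence of edges between different subtrees. At the
  root, the bag of any child becomes the one light part. Finding \<open>u\<close> takes a scan of the
  adjacency list of the parent, and each list is scanned at most \<open>c\<close> times.
\<close>

section \<open>Program logic with running times\<close>

text \<open>Rehanging \<open>u\<close> spoils the search tree, so neither missing edges nor claws
  can be read off the current parent map. All statements therefore refer to the ancestor relation
  \<open>A\<close> of the original tree, which never changes: adjacent vertices are comparable in
  \<open>A\<close>, so an antichain is independent, and the vertices hanging below an unprocessed
  vertex are kept an antichain. It survives rehanging because nothing hangs below the parent of
  \<open>v\<close> through \<open>v\<close> before \<open>v\<close> itself is processed.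

  The factor \<open>c - 1\<close> counts summands: once \<open>u\<close> is removed,
  \<open>v\<close> and \<open>c - 2\<close> bags remain, each of weight at most \<open>lam\<close>.
  The assumption \<open>c >= 3\<close> makes a heavy bag weigh more than \<open>2 * lam\<close>, so
  losing a bag lighter than \<open>lam\<close> leaves at least \<open>lam\<close>. The one light
  part has positive weight, so the other parts together weigh less than \<open>k * lam\<close> and
  there are fewer than \<open>k\<close> of them.

  Parent pointers lead to proper ancestors, which were discovered earlier; a pass in discovery order
  can thus copy labels. Terms linear in the number of vertices are charged to the edges of the
  spanning tree.\<close>

definition run :: "nat \<Rightarrow> com \<Rightarrow> state \<Rightarrow> (nat \<Rightarrow> state \<Rightarrow> bool) \<Rightarrow> bool" where
  "run B p s Q \<longleftrightarrow> (\<exists>t s'. exec B p s t s' \<and> Q t s')"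

lemma run_mono: "run B p s Q \<Longrightarrow> (\<And>t s'. Q t s' \<Longrightarrow> R t s') \<Longrightarrow> run B p s R"
  unfolding run_def by blast

lemma run_Seq: "run B p s (\<lambda>t s'. run B q s' (\<lambda>t'. Q (1 + t + t'))) \<Longrightarrow> run B (Seq p q) s Q"
  unfolding run_def by (blast intro: exec.Seq)

text \<open>\<open>run\<close> asserts an execution, so it includes termination and the absence of
  overflow. \<open>wp\<close> is its version for straight-line code, computed by unfolding; a loop
  is handed back to \<open>run\<close> and treated with \<open>run_While\<close>.\<close>

primrec wp :: "nat \<Rightarrow> com \<Rightarrow> state \<Rightarrow> (nat \<Rightarrow> state \<Rightarrow> bool) \<Rightarrow> bool" where
  "wp B Skip s Q = Q 1 s"
| "wp B (Assign x e) s Q =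
    (afits B e s \<and> Q (1 + acost e) (s\<lparr>vars := (vars s)(x := aval e s)\<rparr>))"
| "wp B (Put a i e) s Q = (afits B i s \<and> afits B e s \<and>
    Q (1 + acost i + acost e) (s\<lparr>arrs := (arrs s)(a := (arrs s a)(aval i s := aval e s))\<rparr>))"
| "wp B (Seq p q) s Q = wp B p s (\<lambda>t s'. wp B q s' (\<lambda>t'. Q (1 + t + t')))"
| "wp B (If b p q) s Q = (bfits B b s \<and>
    (if bval b s then wp B p s (\<lambda>t. Q (1 + bcost b + t)) else wp B q s (\<lambda>t. Q (1 + bcost b + t))))"
| "wp B (While b p) s Q = run B (While b p) s Q"

lemma wp_run: "wp B p s Q \<Longrightarrow> run B p s Q"
proof (induction p arbitrary: s Q)
  case Skip
  then show ?case unfolding run_def wp.simps by (blast intro: exec.Skip)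
next
  case (Assign x e)
  then show ?case unfolding run_def wp.simps by (blast intro: exec.Assign)
next
  case (Put a i e)
  then show ?case unfolding run_def wp.simps by (blast intro: exec.Put)
next
  case (Seq p q)
  have "run B p s (\<lambda>t s'. wp B q s' (\<lambda>t'. Q (1 + t + t')))"
    using Seq.prems by (auto intro: Seq.IH(1))
  then show ?case by (intro run_Seq) (auto elim!: run_mono intro: Seq.IH(2))
next
  case (If b p q)
  have "run B (if bval b s then p else q) s (\<lambda>t. Q (1 + bcost b + t))"
    using If.prems by (auto intro: If.IH)
  then show ?case
    using If.prems unfolding run_def by (fastforce intro: exec.IfTrue exec.IfFalse split: if_splits)
next
  case (While b p)
  then show ?case by simp
qed

inductive_cases exec_SkipE: "exec B Skip s t s'"
inductive_cases exec_AssignE: "exec B (Assign x e) s t s'"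
inductive_cases exec_PutE: "exec B (Put a i e) s t s'"
inductive_cases exec_SeqE: "exec B (Seq p q) s t s'"
inductive_cases exec_IfE: "exec B (If b p q) s t s'"

text \<open>This direction allows a \<open>run\<close> fact about a fragment that contains a loop to
  be spliced into a \<open>wp\<close> goal, and lets \<open>wp\<close> inherit monotonicity from
  \<open>run\<close>.\<close>

lemma run_wp: "run B p s Q \<Longrightarrow> wp B p s Q"
proof (induction p arbitrary: s Q)
  case (Seq p q)
  have "run B p s (\<lambda>t s'. run B q s' (\<lambda>t'. Q (1 + t + t')))"
  proof -
    obtain t s' where "exec B (Seq p q) s t s'" "Q t s'" using Seq.prems unfolding run_def by blast
    then show ?thesis unfolding run_def by (elim exec_SeqE) (intro exI conjI, assumption, assumption, simp)
  qed
  then have "run B p s (\<lambda>t s'. wp B q s' (\<lambda>t'. Q (1 + t + t')))"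
    by (rule run_mono) (rule Seq.IH(2))
  then show ?case by (simp only: wp.simps Seq.IH(1))
next
  case (If b p q)
  then obtain t s' where "exec B (If b p q) s t s'" "Q t s'" unfolding run_def by blast
  then have "bfits B b s" "run B (if bval b s then p else q) s (\<lambda>t. Q (1 + bcost b + t))"
    unfolding run_def by (auto elim!: exec_IfE)
  then show ?case using If.IH by (simp split: if_splits)
qed (auto simp: run_def elim!: exec_SkipE exec_AssignE exec_PutE)

lemma wp_mono: "wp B p s Q \<Longrightarrow> (\<And>t s'. Q t s' \<Longrightarrow> R t s') \<Longrightarrow> wp B p s R"
  by (rule run_wp, rule run_mono[OF wp_run])

text \<open>In \<open>I N s\<close> the number \<open>N\<close> is a time budget that pays for the remaining iterations.\<close>

lemma run_While:
  assumes "I N s"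
    and fits: "\<And>N s. I N s \<Longrightarrow> bfits B b s"
    and body: "\<And>N s. I N s \<Longrightarrow> bval b s \<Longrightarrow>
      run B p s (\<lambda>t s'. \<exists>N'. I N' s' \<and> 1 + bcost b + t + N' \<le> N)"
  shows "run B (While b p) s (\<lambda>t s'. t \<le> N + 1 + bcost b \<and> \<not> bval b s' \<and> (\<exists>N'. I N' s'))"
  using assms(1)
proof (induction N arbitrary: s rule: less_induct)
  case (less N)
  show ?case
  proof (cases "bval b s")
    case True
    then obtain t s' N' where s': "exec B p s t s'" "I N' s'" "1 + bcost b + t + N' \<le> N"
      using body[OF less.prems] unfolding run_def by blast
    then obtain t' s'' where "exec B (While b p) s' t' s''" "t' \<le> N' + 1 + bcost b"
      "\<not> bval b s''" "\<exists>N'. I N' s''"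
      using less.IH[of N' s'] unfolding run_def by auto
    moreover from this have "exec B (While b p) s (1 + bcost b + t + t') s''"
      using exec.WhileTrue fits[OF less.prems] True s'(1) by blast
    ultimately show ?thesis
      using s'(3) unfolding run_def by (intro exI[of _ "1 + bcost b + t + t'"] exI[of _ s'']) auto
  next
    case False
    then show ?thesis
      using exec.WhileFalse[OF fits[OF less.prems] False, of p] less.prems unfolding run_def
      by (intro exI[of _ "1 + bcost b"] exI[of _ s]) auto
  qed
qed

section \<open>Claw-free graphs and connected sets\<close>

text \<open>Together with \<open>v\<close>, any \<open>c\<close> elements of \<open>S\<close> would
  induce a star centred at \<open>v\<close>. Claw-freeness is always used in this form: for the
  children in the search tree, for the roots of the bags hanging below a vertex, and for these
  together with the parent.\<close>

lemma claw_free_card: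
  assumes G: "simple_graph G" "claw_free c G" and S: "\<And>x. x \<in> S \<Longrightarrow> {v, x} \<in> edges G"
    and indep: "\<And>x y. x \<in> S \<Longrightarrow> y \<in> S \<Longrightarrow> {x, y} \<notin> edges G" and v: "v \<in> verts G"
  shows "card S < c"
proof (rule ccontr)
  assume "\<not> card S < c"
  then obtain S' where S': "S' \<subseteq> S" "card S' = c" "finite S'"
    using obtain_subset_with_card_n[of c S] by auto
  have noloop: "{x} \<notin> edges G" for x
    using G(1) unfolding simple_graph_def by fastforce
  have vS: "v \<notin> S'"
    using S[of v] noloop[of v] S'(1) by auto
  have SV: "S' \<subseteq> verts G"
    using S S'(1) G(1) unfolding simple_graph_def by blast
  obtain g where g: "bij_betw g S' {1..c}"
    using finite_same_card_bij[of S' "{1..c}"] S' by auto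
  define f where "f x = (if x = v then 0 else g x)" for x
  have gc: "g x \<in> {1..c}" if "x \<in> S'" for x
    using g that by (auto simp: bij_betw_def)
  have "bij_betw f S' {1..c}"
    using g vS by (subst bij_betw_cong[of S' f g]) (auto simp: f_def)
  then have "bij_betw f (insert v S') (insert (f v) {1..c})"
    using vS by (auto simp: f_def bij_betw_def)
  moreover have "insert (f v) {1..c} = {0..c}" by (auto simp: f_def)
  ultimately have "bij_betw f (insert v S') {0..c}" by simp
  moreover have "verts (induced G (insert v S')) = insert v S'"
    using v SV by (auto simp: induced_def)
  moreover have "{x, y} \<in> edges (induced G (insert v S')) \<longleftrightarrow> {f x, f y} \<in> edges (star c)"
    if xy: "x \<in> insert v S'" "y \<in> insert v S'" for x y
  proof -
    have 1: "{x, y} \<in> edges (induced G (insert v S')) \<longleftrightarrow> {x, y} \<in> edges G"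
      using xy by (auto simp: induced_def)
    have 2: "{f x, f y} \<in> edges (star c) \<longleftrightarrow> (f x = 0 \<and> f y \<in> {1..c}) \<or> (f y = 0 \<and> f x \<in> {1..c})"
      by (auto simp: star_def doubleton_eq_iff)
    consider "x = v" "y = v" | "x = v" "y \<in> S'" | "x \<in> S'" "y = v" | "x \<in> S'" "y \<in> S'"
      using xy by blast
    then show ?thesis
    proof cases
      case 1
      then show ?thesis using noloop 2 by (auto simp: f_def induced_def)
    next
      case 2
      then have "{f x, f y} \<in> edges (star c)" "{x, y} \<in> edges G"
        using vS gc S S'(1) \<open>{f x, f y} \<in> edges (star c) \<longleftrightarrow> _\<close> by (auto simp: f_def)
      then show ?thesis using 1 by simp
    next
      case 3
      then have "{f x, f y} \<in> edges (star c)" "{x, y} \<in> edges G"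
        using vS gc S[of x] S'(1) \<open>{f x, f y} \<in> edges (star c) \<longleftrightarrow> _\<close>
        by (auto simp: f_def insert_commute)
      then show ?thesis using 1 by simp
    next
      case 4
      then have "{x, y} \<notin> edges G" "f x \<noteq> 0" "f y \<noteq> 0"
        using indep S'(1) gc[of x] gc[of y] vS by (auto simp: f_def)
      then show ?thesis using 1 2 by auto
    qed
  qed
  ultimately have "isomorphic (induced G (insert v S')) (star c)"
    unfolding isomorphic_def by (intro exI[of _ f]) (auto simp: star_def)
  then show False
    using G(2) v SV unfolding claw_free_def by blast
qed

text \<open>Handshake count: an incidence is recorded as an edge with one of its two endpoints, and
  these determine the other endpoint.\<close>

lemma sum_degrees_le:
  assumes "simple_graph G"
  shows "(\<Sum>v\<in>verts G. card {u. {u, v} \<in> edges G}) \<le> 2 * card (edges G)"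
proof -
  have e: "e \<subseteq> verts G" "card e = 2" if "e \<in> edges G" for e
    using assms that unfolding simple_graph_def by auto
  have finE: "finite (edges G)"
    using assms finite_subset[of "edges G" "Pow (verts G)"] unfolding simple_graph_def by auto
  have finV: "finite (verts G)" using assms unfolding simple_graph_def by auto
  have fN: "finite {u. {u, v} \<in> edges G}" for v
    by (rule finite_subset[OF _ finV]) (use e(1) in blast)
  have fe: "finite x" if "x \<in> edges G" for x
    using e(1)[OF that] finV finite_subset by blast
  have "(\<Sum>v\<in>verts G. card {u. {u, v} \<in> edges G}) = card (SIGMA v:verts G. {u. {u, v} \<in> edges G})"
    using finV fN by simp
  also have "\<dots> \<le> card (SIGMA x:edges G. x)"
  proof (rule card_inj_on_le[of "\<lambda>(v, u). ({u, v}, v)"])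
    show "inj_on (\<lambda>(v, u). ({u, v}, v)) (SIGMA v:verts G. {u. {u, v} \<in> edges G})"
      by (auto simp: inj_on_def doubleton_eq_iff)
    show "(\<lambda>(v, u). ({u, v}, v)) ` (SIGMA v:verts G. {u. {u, v} \<in> edges G}) \<subseteq> (SIGMA x:edges G. x)"
      by auto
    show "finite (SIGMA x:edges G. x)"
      using finE fe by auto
  qed
  also have "\<dots> = (\<Sum>x\<in>edges G. card x)"
    using finE fe by (intro card_SigmaI) auto
  also have "\<dots> = 2 * card (edges G)"
    using e(2) by simp
  finally show ?thesis .
qed

section \<open>Connectivity of induced subgraphs\<close>

lemma sym_adjacency: "sym (adjacency G)"
  by (auto simp: sym_def adjacency_def insert_commute)

lemma connected_induced_rootI:
  assumes "r \<in> S" "S \<subseteq> verts G" "\<And>x. x \<in> S \<Longrightarrow> (r, x) \<in> (adjacency (induced G S))\<^sup>*"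
  shows "connected_graph (induced G S)"
proof -
  have "(x, r) \<in> (adjacency (induced G S))\<^sup>*" if "x \<in> S" for x
    using assms(3)[OF that] sym_rtrancl[OF sym_adjacency] by (metis symD)
  then show ?thesis
    using assms unfolding connected_graph_def by (auto simp: induced_def intro: rtrancl_trans)
qed

lemma adjacency_induced_mono: "S \<subseteq> S' \<Longrightarrow> adjacency (induced G S) \<subseteq> adjacency (induced G S')"
  by (auto simp: adjacency_def induced_def)

lemma connected_induced_path:
  assumes "connected_graph (induced G S)" "S \<subseteq> verts G" "x \<in> S" "y \<in> S"
  shows "(x, y) \<in> (adjacency (induced G S))\<^sup>*"
proof -
  have "verts (induced G S) = S" using assms(2) by (auto simp: induced_def)
  then show ?thesis using assms unfolding connected_graph_def by blast
qed

lemma connected_induced_singleton: "v \<in> verts G \<Longrightarrow> connected_graph (induced G {v})"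
  by (rule connected_induced_rootI[of v]) auto

text \<open>A bag from which the bag of one child has been cut out has this shape: a centre joined
  to the remaining bags.\<close>

lemma connected_induced_insert_UN:
  assumes r: "r \<in> verts G"
    and S: "\<And>u. u \<in> K \<Longrightarrow> {r, u} \<in> edges G \<and> u \<in> S u \<and> S u \<subseteq> verts G \<and> connected_graph (induced G (S u))"
  shows "connected_graph (induced G (insert r (\<Union>u\<in>K. S u)))" (is "connected_graph (induced G ?U)")
proof (rule connected_induced_rootI[of r])
  show "(r, x) \<in> (adjacency (induced G ?U))\<^sup>*" if x: "x \<in> ?U" for x
  proof (cases "x = r")
    case False
    then obtain u where u: "u \<in> K" "x \<in> S u" using x by blast
    then have "(u, x) \<in> (adjacency (induced G (S u)))\<^sup>*"
      using S[of u] by (intro connected_induced_path) auto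
    moreover have "S u \<subseteq> ?U" using u by blast
    ultimately have "(u, x) \<in> (adjacency (induced G ?U))\<^sup>*"
      using rtrancl_mono[OF adjacency_induced_mono] by blast
    moreover have "(r, u) \<in> adjacency (induced G ?U)"
      using S[of u] u by (auto simp: adjacency_def induced_def)
    ultimately show ?thesis by (rule converse_rtrancl_into_rtrancl[rotated])
  qed simp
qed (use assms in auto)

lemma connected_induced_Un:
  assumes "connected_graph (induced G S)" "connected_graph (induced G S')" "S \<subseteq> verts G" "S' \<subseteq> verts G"
    and "u \<in> S" "u' \<in> S'" "{u, u'} \<in> edges G"
  shows "connected_graph (induced G (S \<union> S'))"
proof (rule connected_induced_rootI[of u])
  show "(u, x) \<in> (adjacency (induced G (S \<union> S')))\<^sup>*" if x: "x \<in> S \<union> S'" for x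
  proof (cases "x \<in> S")
    case True
    then have "(u, x) \<in> (adjacency (induced G S))\<^sup>*"
      using assms by (intro connected_induced_path) auto
    then show ?thesis
      using rtrancl_mono[OF adjacency_induced_mono[of S "S \<union> S'"]] by blast
  next
    case False
    then have "(u', x) \<in> (adjacency (induced G S'))\<^sup>*"
      using assms x by (intro connected_induced_path) auto
    then have "(u', x) \<in> (adjacency (induced G (S \<union> S')))\<^sup>*"
      using rtrancl_mono[OF adjacency_induced_mono[of S' "S \<union> S'"]] by blast
    moreover have "(u, u') \<in> adjacency (induced G (S \<union> S'))"
      using assms by (auto simp: adjacency_def induced_def)
    ultimately show ?thesis by (rule converse_rtrancl_into_rtrancl[rotated])
  qed
qed (use assms in auto)

locale bcp_instance =
  fixes G :: "nat graph" and n :: nat and nbrs :: "nat \<Rightarrow> nat list" and w :: "nat \<Rightarrow> nat"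
    and k c :: nat
  assumes simple: "simple_graph G" and conn: "connected_graph G" and claw: "claw_free c G"
    and V: "verts G = {..<n}" and lists: "adjacency_lists G nbrs"
    and w_pos: "v < n \<Longrightarrow> w v \<ge> 1" and k_pos: "k \<ge> 1" and c_ge: "c \<ge> 3"
begin

definition adj :: "nat \<Rightarrow> nat \<Rightarrow> bool" where
  "adj u v \<longleftrightarrow> {u, v} \<in> edges G"

definition deg :: "nat \<Rightarrow> nat" where
  "deg v = length (nbrs v)"

lemma adj_sym: "adj u v \<longleftrightarrow> adj v u"
  by (simp add: adj_def insert_commute)

lemma adj_irrefl: "\<not> adj v v"
  using simple unfolding simple_graph_def adj_def by fastforce

lemma adj_less: "adj u v \<Longrightarrow> u < n \<and> v < n"
  using simple V unfolding simple_graph_def adj_def by fastforce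

lemma n_pos: "0 < n"
  using conn V unfolding connected_graph_def by auto

lemma set_nbrs: "v < n \<Longrightarrow> set (nbrs v) = {u. adj v u}"
  using lists V unfolding adjacency_lists_def adj_def by (auto simp: insert_commute)

lemma sum_deg_le: "(\<Sum>v<n. deg v) \<le> 2 * card (edges G)"
proof -
  have "deg v = card {u. {u, v} \<in> edges G}" if "v < n" for v
    using lists that V unfolding adjacency_lists_def deg_def by (metis distinct_card lessThan_iff)
  then show ?thesis using sum_degrees_le[OF simple] V by simp
qed

lemma reaches_all:
  assumes "0 \<in> X" "\<And>u v. u \<in> X \<Longrightarrow> adj u v \<Longrightarrow> v \<in> X" "v < n"
  shows "v \<in> X"
proof -
  have "(0, v) \<in> (adjacency G)\<^sup>*"
    using conn assms(3) V unfolding connected_graph_def by auto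
  then show ?thesis
    by (induction rule: rtrancl_induct) (use assms in \<open>auto simp: adjacency_def adj_def\<close>)
qed

subsection \<open>Depth-first search\<close>

text \<open>\<open>A v\<close> is the set of ancestors of \<open>v\<close>, including \<open>v\<close>, in the tree given by \<open>par\<close>; the
  vertices \<open>ord 0, \<dots>, ord (m - 1)\<close> are those discovered so far.\<close>

definition tree_inv ::
    "(nat \<Rightarrow> nat) \<Rightarrow> (nat \<Rightarrow> nat) \<Rightarrow> nat \<Rightarrow> (nat \<Rightarrow> nat set) \<Rightarrow> bool" where
  "tree_inv par ord m A \<longleftrightarrow>
     0 < m \<and> inj_on ord {..<m} \<and> ord ` {..<m} \<subseteq> {..<n} \<and> ord 0 = 0 \<and> par 0 = 0 \<and> A 0 = {0} \<and>
     (\<forall>i<m. 0 < i \<longrightarrow> (\<exists>j<i. par (ord i) = ord j \<and> adj (ord j) (ord i) \<and>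
        A (ord i) = insert (ord i) (A (ord j)))) \<and>
     (\<forall>i<m. \<forall>x\<in>A (ord i). \<exists>j\<le>i. x = ord j) \<and>
     (\<forall>v\<in>ord ` {..<m}. v \<in> A v \<and> (\<forall>u\<in>A v. A u \<subseteq> A v) \<and>
        (\<forall>x\<in>A v. \<forall>y\<in>A v. x \<in> A y \<or> y \<in> A x)) \<and>
     (\<forall>u\<in>ord ` {..<m}. \<forall>v\<in>ord ` {..<m}. adj u v \<longrightarrow> u \<in> A v \<or> v \<in> A u)"

text \<open>\<open>A cur\<close> is the search stack. Discovered vertices that have left it are
  exhausted, that is, \<open>ptr\<close> has run through their whole list; this is what excludes
  cross edges in \<open>tree_inv\<close>.\<close>

definition search_inv ::
    "nat \<Rightarrow> (nat \<Rightarrow> nat) \<Rightarrow> (nat \<Rightarrow> nat) \<Rightarrow> nat \<Rightarrow> (nat \<Rightarrow> nat set) \<Rightarrow> bool" where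
  "search_inv cur ptr ord m A \<longleftrightarrow>
     cur \<in> ord ` {..<m} \<and> (\<forall>v\<in>ord ` {..<m} - A cur. ptr v = deg v) \<and>
     (\<forall>v<n. ptr v \<le> deg v) \<and> (\<forall>v<n. v \<notin> ord ` {..<m} \<longrightarrow> ptr v = 0) \<and>
     (\<forall>v\<in>ord ` {..<m}. \<forall>i<ptr v. nbrs v ! i \<in> ord ` {..<m})"

lemma tree_invD:
  assumes T: "tree_inv par ord m A"
  shows "0 < m" "inj_on ord {..<m}" "ord ` {..<m} \<subseteq> {..<n}" "ord 0 = 0" "par 0 = 0" "A 0 = {0}"
    and "\<And>i. i < m \<Longrightarrow> 0 < i \<Longrightarrow>
      \<exists>j<i. par (ord i) = ord j \<and> adj (ord j) (ord i) \<and> A (ord i) = insert (ord i) (A (ord j))"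
    and "\<And>i x. i < m \<Longrightarrow> x \<in> A (ord i) \<Longrightarrow> \<exists>j\<le>i. x = ord j"
    and "\<And>v. v \<in> ord ` {..<m} \<Longrightarrow> v \<in> A v"
    and "\<And>u v. v \<in> ord ` {..<m} \<Longrightarrow> u \<in> A v \<Longrightarrow> A u \<subseteq> A v"
    and "\<And>v x y. v \<in> ord ` {..<m} \<Longrightarrow> x \<in> A v \<Longrightarrow> y \<in> A v \<Longrightarrow> x \<in> A y \<or> y \<in> A x"
    and "\<And>u v. u \<in> ord ` {..<m} \<Longrightarrow> v \<in> ord ` {..<m} \<Longrightarrow> adj u v \<Longrightarrow> u \<in> A v \<or> v \<in> A u"
  using T unfolding tree_inv_def by (simp_all del: ball_simps)

lemma tree_inv_init: "tree_inv (\<lambda>_. 0) (\<lambda>_. 0) 1 (\<lambda>_. {0})"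
  using n_pos adj_irrefl unfolding tree_inv_def by (auto simp: inj_on_def)

lemma search_inv_init: "search_inv 0 (\<lambda>_. 0) (\<lambda>_. 0) 1 (\<lambda>_. {0})"
  unfolding search_inv_def by auto

lemma tree_inv_le: "tree_inv par ord m A \<Longrightarrow> m \<le> n"
  unfolding tree_inv_def by (metis card_image card_lessThan card_mono finite_lessThan)

lemma tree_inv_subset:
  "tree_inv par ord m A \<Longrightarrow> v \<in> ord ` {..<m} \<Longrightarrow> A v \<subseteq> ord ` {..<m}"
  using tree_invD(8) by fastforce

lemma nth_nbrs_adj: "v < n \<Longrightarrow> i < deg v \<Longrightarrow> adj v (nbrs v ! i)"
  using set_nbrs nth_mem unfolding deg_def by fastforce

text \<open>A discovered neighbour of \<open>u\<close> off the stack would be exhausted and would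
  have discovered \<open>u\<close> itself. So all discovered neighbours of \<open>u\<close> lie in
  \<open>A cur\<close>, and the new edges join comparable vertices.\<close>

lemma tree_inv_discover:
  assumes T: "tree_inv par ord m A" and S: "search_inv cur ptr ord m A"
    and u: "u \<notin> ord ` {..<m}" "adj cur u"
  shows "tree_inv (par(u := cur)) (ord(m := u)) (Suc m) (A(u := insert u (A cur)))"
proof -
  let ?X = "ord ` {..<m}"
  obtain ic where ic: "ic < m" "cur = ord ic" using S unfolding search_inv_def by auto
  have cX: "cur \<in> ?X" using ic by auto
  have img: "(ord(m := u)) ` {..<Suc m} = insert u ?X"
    by (auto simp: lessThan_Suc)
  have u0: "u \<noteq> 0" using u(1) tree_invD(1,4)[OF T] by (metis imageI lessThan_iff)
  have uA: "u \<notin> A v" if "v \<in> ?X" for v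
    using tree_inv_subset[OF T that] u(1) by blast
  have black: "v \<in> A cur" if v: "v \<in> ?X" "adj u v" for v
  proof (rule ccontr)
    assume "v \<notin> A cur"
    then have "ptr v = deg v" using S v unfolding search_inv_def by auto
    moreover have "u \<in> set (nbrs v)"
      using set_nbrs adj_less v(2) adj_sym by blast
    then obtain i where "i < deg v" "nbrs v ! i = u"
      by (auto simp: in_set_conv_nth deg_def)
    ultimately show False using S v(1) u(1) unfolding search_inv_def by metis
  qed
  have Acur: "cur \<in> A cur" "\<And>x. x \<in> A cur \<Longrightarrow> A x \<subseteq> A cur" "\<And>x y. x \<in> A cur \<Longrightarrow> y \<in> A cur \<Longrightarrow> x \<in> A y \<or> y \<in> A x"
    using tree_invD(9-11)[OF T cX] by blast+
  have 1: "inj_on (ord(m := u)) {..<Suc m}"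
    using T u(1) unfolding tree_inv_def by (auto simp: inj_on_def less_Suc_eq)
  have 2: "\<exists>j<i. (par(u := cur)) ((ord(m := u)) i) = (ord(m := u)) j \<and> adj ((ord(m := u)) j) ((ord(m := u)) i) \<and>
        (A(u := insert u (A cur))) ((ord(m := u)) i) = insert ((ord(m := u)) i) ((A(u := insert u (A cur))) ((ord(m := u)) j))"
    if i: "i < Suc m" "0 < i" for i
  proof (cases "i = m")
    case True
    then show ?thesis using ic u by (intro exI[of _ ic]) (auto simp: adj_irrefl)
  next
    case False
    then obtain j where "j < i" "par (ord i) = ord j" "adj (ord j) (ord i)"
        "A (ord i) = insert (ord i) (A (ord j))"
      using tree_invD(7)[OF T, of i] i by auto
    moreover have "ord i \<noteq> u" "ord j \<noteq> u"
      using u(1) i False \<open>j < i\<close> by auto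
    ultimately show ?thesis using i False by (intro exI[of _ j]) auto
  qed
  have 3: "\<exists>j\<le>i. x = (ord(m := u)) j" if ix: "i < Suc m" "x \<in> (A(u := insert u (A cur))) ((ord(m := u)) i)" for i x
  proof (cases "i = m")
    case True
    then have "x = u \<or> x \<in> A (ord ic)" using ix ic by auto
    then show ?thesis
    proof
      assume "x \<in> A (ord ic)"
      then obtain j where "j \<le> ic" "x = ord j" using tree_invD(8)[OF T] ic by blast
      then show ?thesis using True ic by (intro exI[of _ j]) auto
    qed (use True in auto)
  next
    case False
    then have "i < m" "ord i \<noteq> u" using ix u(1) by auto
    then obtain j where "j \<le> i" "x = ord j" using tree_invD(8)[OF T, of i x] ix by auto
    then show ?thesis using \<open>i < m\<close> by (intro exI[of _ j]) auto
  qed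
  have 4: "v \<in> A' v \<and> (\<forall>x\<in>A' v. A' x \<subseteq> A' v) \<and> (\<forall>x\<in>A' v. \<forall>y\<in>A' v. x \<in> A' y \<or> y \<in> A' x)"
    if "v \<in> insert u ?X" and A': "A' = A(u := insert u (A cur))" for v A'
  proof (cases "v = u")
    case True
    have "u \<notin> A cur" using uA cX by auto
    then show ?thesis using True Acur unfolding A' by auto
  next
    case False
    then have "v \<in> ?X" "u \<notin> A v" using that uA by auto
    then show ?thesis using tree_invD(9-11)[OF T, of v] unfolding A' by (auto simp: False)
  qed
  have 5: "x \<in> A' v \<or> v \<in> A' x"
    if xv: "x \<in> insert u ?X" "v \<in> insert u ?X" "adj x v" and A': "A' = A(u := insert u (A cur))" for x v A'
  proof -
    consider "x = u" "v = u" | "x = u" "v \<in> ?X" | "x \<in> ?X" "v = u" | "x \<in> ?X" "v \<in> ?X" "x \<noteq> u" "v \<noteq> u"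
      using xv by blast
    then show ?thesis
    proof cases
      case 4
      then show ?thesis using tree_invD(12)[OF T, of x v] that by auto
    qed (use xv A' black adj_sym in auto)
  qed
  have 6: "insert u ?X \<subseteq> {..<n}" "0 < Suc m" "(ord(m := u)) 0 = 0" "(par(u := cur)) 0 = 0"
    "(A(u := insert u (A cur))) 0 = {0}"
    using tree_invD(1,3-6)[OF T] u0 adj_less[OF u(2)] by auto
  show ?thesis
    unfolding tree_inv_def img
    by (intro conjI; (intro allI ballI impI)?; (rule 1 2 3 4[OF _ refl] 5[OF _ _ _ refl] 6; assumption))
qed

lemma search_inv_discover:
  assumes T: "tree_inv par ord m A" and S: "search_inv cur ptr ord m A"
    and u: "u \<notin> ord ` {..<m}" "u = nbrs cur ! ptr cur" "ptr cur < deg cur"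
  shows "search_inv u (ptr(cur := Suc (ptr cur))) (ord(m := u)) (Suc m) (A(u := insert u (A cur)))"
proof -
  have img: "(ord(m := u)) ` {..<Suc m} = insert u (ord ` {..<m})"
    by (auto simp: lessThan_Suc)
  have "cur \<in> ord ` {..<m}" using S unfolding search_inv_def by auto
  moreover from this have "cur \<in> A cur" "cur < n" "cur \<noteq> u"
    using tree_invD(3,9)[OF T] u by auto
  moreover have "u < n" using nth_nbrs_adj \<open>cur < n\<close> u adj_less by blast
  moreover have "ptr u = 0" using S u \<open>u < n\<close> unfolding search_inv_def by auto
  ultimately show ?thesis
    using S u unfolding search_inv_def img by (auto simp: less_Suc_eq)
qed

lemma search_inv_skip:
  assumes T: "tree_inv par ord m A" and S: "search_inv cur ptr ord m A"
    and u: "nbrs cur ! ptr cur \<in> ord ` {..<m}" "ptr cur < deg cur"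
  shows "search_inv cur (ptr(cur := Suc (ptr cur))) ord m A"
proof -
  have "cur \<in> ord ` {..<m}" using S unfolding search_inv_def by auto
  moreover from this have "cur \<in> A cur" "cur < n"
    using tree_invD(3,9)[OF T] by auto
  ultimately show ?thesis using S u unfolding search_inv_def by (auto simp: less_Suc_eq)
qed

lemma tree_inv_par:
  assumes T: "tree_inv par ord m A" and v: "v \<in> ord ` {..<m}" "v \<noteq> 0"
  shows "par v \<in> ord ` {..<m}" "adj (par v) v" "A v = insert v (A (par v))" "v \<notin> A (par v)"
proof -
  obtain i where i: "i < m" "v = ord i" "0 < i"
    using v tree_invD(4)[OF T] by (metis gr0I imageE lessThan_iff)
  then obtain j where j: "j < i" "par v = ord j" "adj (ord j) v" "A v = insert v (A (ord j))"
    using tree_invD(7)[OF T, of i] by auto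
  then show "par v \<in> ord ` {..<m}" "adj (par v) v" "A v = insert v (A (par v))"
    using i by auto
  show "v \<notin> A (par v)"
  proof
    assume "v \<in> A (par v)"
    then obtain l where l: "l \<le> j" "v = ord l" using tree_invD(8)[OF T, of j v] i j by auto
    have "l = i" using inj_onD[OF tree_invD(2)[OF T], of l i] l i j by auto
    then show False using l j by auto
  qed
qed

lemma search_inv_retreat:
  assumes T: "tree_inv par ord m A" and S: "search_inv cur ptr ord m A"
    and "ptr cur = deg cur" "cur \<noteq> 0"
  shows "search_inv (par cur) ptr ord m A"
  using tree_inv_par[OF T _ \<open>cur \<noteq> 0\<close>] assms unfolding search_inv_def by auto

text \<open>The stack is \<open>{0}\<close> and the root is exhausted, so every discovered vertex
  is; the discovered set is then closed under adjacency, and connectedness makes it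
  everything.\<close>

lemma search_inv_finish:
  assumes T: "tree_inv par ord m A" and S: "search_inv 0 ptr ord m A" and "ptr 0 = deg 0"
  shows "m = n" "ord ` {..<n} = {..<n}"
proof -
  have full: "ptr v = deg v" if "v \<in> ord ` {..<m}" for v
    using S tree_invD(6)[OF T] \<open>ptr 0 = deg 0\<close> that unfolding search_inv_def by (cases "v = 0") auto
  have closed: "v \<in> ord ` {..<m}" if "u \<in> ord ` {..<m}" "adj u v" for u v
  proof -
    have "v \<in> set (nbrs u)" using set_nbrs adj_less that by blast
    then obtain i where "i < deg u" "nbrs u ! i = v" by (auto simp: in_set_conv_nth deg_def)
    then show ?thesis using S full that unfolding search_inv_def by metis
  qed
  have "{..<n} \<subseteq> ord ` {..<m}"
    using reaches_all[of "ord ` {..<m}"] closed tree_invD(1,4)[OF T] by (metis imageI lessThan_iff subsetI)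
  moreover have "ord ` {..<m} \<subseteq> {..<n}" using tree_invD(3)[OF T] .
  ultimately have eq: "ord ` {..<m} = {..<n}" by auto
  then have "card (ord ` {..<m}) = n" by simp
  moreover have "card (ord ` {..<m}) = m" using tree_invD(2)[OF T] by (simp add: card_image)
  ultimately show "m = n" by simp
  then show "ord ` {..<n} = {..<n}" using eq by simp
qed

text \<open>The tree edges of the vertices other than \<open>0\<close> are distinct, because two
  vertices cannot be parents of each other. This turns costs linear in \<open>n\<close> into costs
  linear in the number of edges.\<close>

lemma card_verts_le:
  assumes T: "tree_inv par ord n A" and "ord ` {..<n} = {..<n}"
  shows "n \<le> Suc (card (edges G))"
proof -
  note P = tree_inv_par[OF T, unfolded assms(2)]
  have "card {1..<n} \<le> card (edges G)"
  proof (rule card_inj_on_le[of "\<lambda>v. {par v, v}"])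
    show "inj_on (\<lambda>v. {par v, v}) {1..<n}"
    proof (rule inj_onI)
      fix u v assume uv: "u \<in> {1..<n}" "v \<in> {1..<n}" "{par u, u} = {par v, v}"
      show "u = v"
      proof (rule ccontr)
        assume "u \<noteq> v"
        then have "u = par v" "v = par u" using uv(3) by (auto simp: doubleton_eq_iff)
        moreover have "u \<in> A u" using tree_invD(9)[OF T] assms(2) uv(1) by auto
        ultimately show False using P(3)[of v] P(4)[of u] uv by (metis P(3) atLeastLessThan_iff
          insert_iff lessThan_iff not_one_le_zero)
      qed
    qed
    show "(\<lambda>v. {par v, v}) ` {1..<n} \<subseteq> edges G"
      using P(2) unfolding adj_def by auto
    show "finite (edges G)"
      using simple finite_subset[of "edges G" "Pow (verts G)"] unfolding simple_graph_def by auto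
  qed
  then show ?thesis by simp
qed

end

section \<open>Cutting the search tree into bags\<close>

text \<open>Set-level effect of a light vertex: \<open>v\<close> stops being a root and
  \<open>p\<close> takes over its block.\<close>

lemma disjoint_family_on_absorb:
  assumes "disjoint_family_on T (insert v R)" "p \<in> R" "v \<notin> R"
  shows "disjoint_family_on (T(p := T p \<union> T v)) R"
    "(\<Union>r\<in>R. (T(p := T p \<union> T v)) r) = (\<Union>r\<in>insert v R. T r)"
proof -
  have "T r \<inter> T s = {}" if "r \<in> insert v R" "s \<in> insert v R" "r \<noteq> s" for r s
    using assms(1) that unfolding disjoint_family_on_def by blast
  then show "disjoint_family_on (T(p := T p \<union> T v)) R"
    using assms(2,3) unfolding disjoint_family_on_def by (auto simp: Int_Un_distrib Int_Un_distrib2)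
  show "(\<Union>r\<in>R. (T(p := T p \<union> T v)) r) = (\<Union>r\<in>insert v R. T r)"
    using assms(2) by auto
qed

text \<open>Set-level effect of a heavy vertex: the roots stay, and the bag \<open>D\<close> of one
  child moves from \<open>v\<close> to \<open>p\<close>.\<close>

lemma disjoint_family_on_move:
  assumes "disjoint_family_on T R" "p \<in> R" "v \<in> R" "p \<noteq> v" "D \<subseteq> T v"
  shows "disjoint_family_on (T(v := T v - D, p := T p \<union> D)) R"
    "(\<Union>r\<in>R. (T(v := T v - D, p := T p \<union> D)) r) = (\<Union>r\<in>R. T r)"
proof -
  have "T r \<inter> T s = {}" if "r \<in> R" "s \<in> R" "r \<noteq> s" for r s
    using assms(1) that unfolding disjoint_family_on_def by blast
  then show "disjoint_family_on (T(v := T v - D, p := T p \<union> D)) R"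
    using assms(2-5) unfolding disjoint_family_on_def by auto
  show "(\<Union>r\<in>R. (T(v := T v - D, p := T p \<union> D)) r) = (\<Union>r\<in>R. T r)"
    using assms(2-5) by (auto split: if_splits)
qed

context bcp_instance
begin

definition total :: nat where
  "total = sum w {..<n}"

definition lam :: nat where
  "lam = max (Max (w ` {..<n})) ((total + k - 1) div k)"

lemma w_le_lam: "v < n \<Longrightarrow> w v \<le> lam"
  unfolding lam_def by (simp add: le_max_iff_disj)

lemma total_le: "total \<le> k * lam"
proof -
  have "total \<le> k * ((total + k - 1) div k)"
    using k_pos dividend_less_times_div[of k "total + k - 1"] by simp
  also have "\<dots> \<le> k * lam" unfolding lam_def by simp
  finally show ?thesis .
qed

end

section \<open>Ancestor order of the finished search tree\<close>

locale dfs_tree = bcp_instance +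
  fixes par ord :: "nat \<Rightarrow> nat" and A :: "nat \<Rightarrow> nat set"
  assumes tree: "tree_inv par ord n A" and onto: "ord ` {..<n} = {..<n}"
begin

lemma A_refl: "v < n \<Longrightarrow> v \<in> A v"
  using tree_invD(9)[OF tree] onto by simp

lemma A_trans: "v < n \<Longrightarrow> u \<in> A v \<Longrightarrow> x \<in> A u \<Longrightarrow> x \<in> A v"
  using tree_invD(10)[OF tree] onto by blast

lemma A_linear: "v < n \<Longrightarrow> x \<in> A v \<Longrightarrow> y \<in> A v \<Longrightarrow> x \<in> A y \<or> y \<in> A x"
  using tree_invD(11)[OF tree] onto by blast

lemma A_edge: "adj u v \<Longrightarrow> u \<in> A v \<or> v \<in> A u"
  using tree_invD(12)[OF tree] adj_less[of u v] unfolding onto by blast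

lemma ord_inj: "i < n \<Longrightarrow> j < n \<Longrightarrow> ord i = ord j \<longleftrightarrow> i = j"
  using tree_invD(2)[OF tree] by (auto dest: inj_onD)

lemma ord_less: "i < n \<Longrightarrow> ord i < n"
  using onto by blast

lemma ord_0: "ord 0 = 0"
  using tree_invD(4)[OF tree] .

lemma ord_eq_0: "i < n \<Longrightarrow> ord i = 0 \<longleftrightarrow> i = 0"
  using ord_inj[of i 0] ord_0 by auto

lemma A_ord: "i < n \<Longrightarrow> u \<in> A (ord i) \<Longrightarrow> \<exists>j\<le>i. u = ord j"
  using tree_invD(8)[OF tree] .

lemma par_ord: "i < n \<Longrightarrow> 0 < i \<Longrightarrow> \<exists>j<i. par (ord i) = ord j"
  using tree_invD(7)[OF tree] by blast

lemma ordE: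
  assumes "v < n"
  obtains i where "i < n" "v = ord i"
  using assms onto by (metis imageE lessThan_iff)

text \<open>An ancestor is discovered no later than its descendants, and \<open>ord\<close> is
  injective.\<close>

lemma A_antisym:
  assumes "v < n" "u \<in> A v" "v \<in> A u"
  shows "u = v"
proof -
  obtain i where i: "i < n" "v = ord i" using assms(1) by (rule ordE)
  obtain j where j: "j \<le> i" "u = ord j" using A_ord i assms(2) by blast
  obtain l where l: "l \<le> j" "v = ord l" using A_ord[of j v] i j assms(3) by auto
  have "l = i" using ord_inj[of l i] i j l by auto
  then show ?thesis using j l by auto
qed

lemma par_0: "par 0 = 0"
  using tree_invD(5)[OF tree] .

lemma par_facts:
  assumes "v < n" "v \<noteq> 0"
  shows "par v < n" "adj (par v) v" "A v = insert v (A (par v))" "v \<notin> A (par v)"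
    "par v \<in> A v" "par v \<noteq> v"
proof -
  show *: "par v < n" "adj (par v) v" "A v = insert v (A (par v))" "v \<notin> A (par v)"
    using tree_inv_par[OF tree, of v] assms unfolding onto by auto
  show "par v \<in> A v" "par v \<noteq> v"
    using * A_refl[of "par v"] by auto
qed

text \<open>The owners of the current blocks: an unprocessed vertex owns the bag collected so far, a
  marked vertex a finished part. Every other vertex has been absorbed by one of them.\<close>

definition roots :: "nat \<Rightarrow> (nat \<Rightarrow> nat) \<Rightarrow> nat set" where
  "roots i mark = ord ` {..<i} \<union> {v. v < n \<and> mark v \<noteq> 0}"

text \<open>Children in the sense of the current map \<open>f\<close>, not of the search tree: a
  marked tree child is missing, and a rehung deeper descendant is present.\<close>

definition kids :: "nat \<Rightarrow> (nat \<Rightarrow> nat) \<Rightarrow> (nat \<Rightarrow> nat) \<Rightarrow> nat \<Rightarrow> nat set" where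
  "kids i f mark v = {u. u < n \<and> u \<notin> roots i mark \<and> f u = v}"

text \<open>The vertices \<open>ord 0, \<dots>, ord (i - 1)\<close> have not been processed yet. A processed vertex is
  the root of a finished part if \<open>mark\<close> is set, and otherwise its bag \<open>T\<close> hangs below \<open>f\<close>.\<close>

definition bag_inv :: "nat \<Rightarrow> (nat \<Rightarrow> nat) \<Rightarrow> (nat \<Rightarrow> nat) \<Rightarrow> (nat \<Rightarrow> nat) \<Rightarrow> (nat \<Rightarrow> nat set) \<Rightarrow> bool" where
  "bag_inv i f sub mark T \<longleftrightarrow>
     (\<forall>v\<in>ord ` {..<i}. f v = par v \<and> mark v = 0) \<and>
     (\<forall>v<n. v \<in> T v \<and> (\<forall>x\<in>T v. x < n \<and> v \<in> A x) \<and> connected_graph (induced G (T v)) \<and>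
        sub v = sum w (T v)) \<and>
     disjoint_family_on T (roots i mark) \<and> (\<Union>r\<in>roots i mark. T r) = {..<n} \<and>
     (\<forall>r\<in>roots i mark. \<forall>u\<in>T r. u \<noteq> r \<longrightarrow> f u \<in> T r) \<and>
     (\<forall>u<n. u \<notin> roots i mark \<longrightarrow> f u < n \<and> f u \<in> A u \<and> f u \<noteq> u \<and> adj (f u) u \<and> sub u < lam) \<and>
     (\<forall>v\<in>ord ` {..<i}. T v = insert v (\<Union>u\<in>kids i f mark v. T u)) \<and>
     (\<forall>v\<in>ord ` {..<i}. \<forall>u\<in>kids i f mark v. \<forall>x\<in>A u. v \<in> A x \<longrightarrow> x \<noteq> v \<longrightarrow> x \<notin> ord ` {..<i}) \<and>
     (\<forall>v\<in>ord ` {..<i}. \<forall>u\<in>kids i f mark v. \<forall>u'\<in>kids i f mark v. u \<noteq> u' \<longrightarrow> u \<notin> A u') \<and>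
     (\<forall>v<n. mark v \<noteq> 0 \<longrightarrow> lam \<le> sub v \<and> sub v \<le> (c - 1) * lam)"

text \<open>The facts on \<open>T\<close> and \<open>sub\<close> also hold for absorbed vertices,
  since such a bag may have to be cut out again. The clause with \<open>x\<close> says that all
  vertices below \<open>v\<close> on the tree path to a kid are processed. It protects the antichain
  clause after it, from which nonadjacency of the kids follows.\<close>

lemma bag_invD:
  assumes I: "bag_inv i f sub mark T"
  shows "\<And>v. v \<in> ord ` {..<i} \<Longrightarrow> f v = par v"
    and "\<And>v. v \<in> ord ` {..<i} \<Longrightarrow> mark v = 0"
    and "\<And>v. v < n \<Longrightarrow> v \<in> T v"
    and "\<And>v x. v < n \<Longrightarrow> x \<in> T v \<Longrightarrow> x < n"
    and "\<And>v x. v < n \<Longrightarrow> x \<in> T v \<Longrightarrow> v \<in> A x"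
    and "\<And>v. v < n \<Longrightarrow> connected_graph (induced G (T v))"
    and "\<And>v. v < n \<Longrightarrow> sub v = sum w (T v)"
    and "disjoint_family_on T (roots i mark)" 
    and "(\<Union>r\<in>roots i mark. T r) = {..<n}"
    and "\<And>r u. r \<in> roots i mark \<Longrightarrow> u \<in> T r \<Longrightarrow> u \<noteq> r \<Longrightarrow> f u \<in> T r"
    and "\<And>u. u < n \<Longrightarrow> u \<notin> roots i mark \<Longrightarrow> f u < n \<and> f u \<in> A u \<and> f u \<noteq> u \<and> adj (f u) u \<and> sub u < lam"
    and "\<And>v. v \<in> ord ` {..<i} \<Longrightarrow> T v = insert v (\<Union>u\<in>kids i f mark v. T u)"
    and "\<And>v u x. v \<in> ord ` {..<i} \<Longrightarrow> u \<in> kids i f mark v \<Longrightarrow> x \<in> A u \<Longrightarrow> v \<in> A x \<Longrightarrow> x \<noteq> v \<Longrightarrow>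
      x \<notin> ord ` {..<i}"
    and "\<And>v u u'. v \<in> ord ` {..<i} \<Longrightarrow> u \<in> kids i f mark v \<Longrightarrow> u' \<in> kids i f mark v \<Longrightarrow> u \<noteq> u' \<Longrightarrow> u \<notin> A u'"
    and "\<And>v. v < n \<Longrightarrow> mark v \<noteq> 0 \<Longrightarrow> lam \<le> sub v \<and> sub v \<le> (c - 1) * lam"
proof -
  note D = I[unfolded bag_inv_def]
  show "\<And>v. v \<in> ord ` {..<i} \<Longrightarrow> f v = par v"
    by (rule D[THEN conjunct1, rule_format, THEN conjunct1]; assumption)
  show "\<And>v. v \<in> ord ` {..<i} \<Longrightarrow> mark v = 0"
    by (rule D[THEN conjunct1, rule_format, THEN conjunct2]; assumption)
  show "\<And>v. v < n \<Longrightarrow> v \<in> T v"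
    by (rule D[THEN conjunct2, THEN conjunct1, rule_format, THEN conjunct1]; assumption)
  show "\<And>v x. v < n \<Longrightarrow> x \<in> T v \<Longrightarrow> x < n"
    by (rule bspec[OF D[THEN conjunct2, THEN conjunct1, rule_format, THEN conjunct2, THEN conjunct1], THEN conjunct1]; assumption)
  show "\<And>v x. v < n \<Longrightarrow> x \<in> T v \<Longrightarrow> v \<in> A x"
    by (rule bspec[OF D[THEN conjunct2, THEN conjunct1, rule_format, THEN conjunct2, THEN conjunct1], THEN conjunct2]; assumption)
  show "\<And>v. v < n \<Longrightarrow> connected_graph (induced G (T v))"
    by (rule D[THEN conjunct2, THEN conjunct1, rule_format, THEN conjunct2, THEN conjunct2, THEN conjunct1]; assumption)
  show "\<And>v. v < n \<Longrightarrow> sub v = sum w (T v)"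
    by (rule D[THEN conjunct2, THEN conjunct1, rule_format, THEN conjunct2, THEN conjunct2, THEN conjunct2]; assumption)
  show "disjoint_family_on T (roots i mark)"
    by (rule D[THEN conjunct2, THEN conjunct2, THEN conjunct1])
  show "(\<Union>r\<in>roots i mark. T r) = {..<n}"
    by (rule D[THEN conjunct2, THEN conjunct2, THEN conjunct2, THEN conjunct1])
  show "\<And>r u. r \<in> roots i mark \<Longrightarrow> u \<in> T r \<Longrightarrow> u \<noteq> r \<Longrightarrow> f u \<in> T r"
    by (rule D[THEN conjunct2, THEN conjunct2, THEN conjunct2, THEN conjunct2, THEN conjunct1, rule_format]; assumption)
  show "\<And>u. u < n \<Longrightarrow> u \<notin> roots i mark \<Longrightarrow> f u < n \<and> f u \<in> A u \<and> f u \<noteq> u \<and> adj (f u) u \<and> sub u < lam"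
    by (rule D[THEN conjunct2, THEN conjunct2, THEN conjunct2, THEN conjunct2, THEN conjunct2, THEN conjunct1, rule_format]; assumption)
  show "\<And>v. v \<in> ord ` {..<i} \<Longrightarrow> T v = insert v (\<Union>u\<in>kids i f mark v. T u)"
    by (rule D[THEN conjunct2, THEN conjunct2, THEN conjunct2, THEN conjunct2, THEN conjunct2, THEN conjunct2, THEN conjunct1, rule_format]; assumption)
  show "\<And>v u x. v \<in> ord ` {..<i} \<Longrightarrow> u \<in> kids i f mark v \<Longrightarrow> x \<in> A u \<Longrightarrow> v \<in> A x \<Longrightarrow> x \<noteq> v \<Longrightarrow>
      x \<notin> ord ` {..<i}"
    by (rule D[THEN conjunct2, THEN conjunct2, THEN conjunct2, THEN conjunct2, THEN conjunct2, THEN conjunct2, THEN conjunct2, THEN conjunct1, rule_format]; assumption)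
  show "\<And>v u u'. v \<in> ord ` {..<i} \<Longrightarrow> u \<in> kids i f mark v \<Longrightarrow> u' \<in> kids i f mark v \<Longrightarrow> u \<noteq> u' \<Longrightarrow> u \<notin> A u'"
    by (rule D[THEN conjunct2, THEN conjunct2, THEN conjunct2, THEN conjunct2, THEN conjunct2, THEN conjunct2, THEN conjunct2, THEN conjunct2, THEN conjunct1, rule_format]; assumption)
  show "\<And>v. v < n \<Longrightarrow> mark v \<noteq> 0 \<Longrightarrow> lam \<le> sub v \<and> sub v \<le> (c - 1) * lam"
    by (rule D[THEN conjunct2, THEN conjunct2, THEN conjunct2, THEN conjunct2, THEN conjunct2, THEN conjunct2, THEN conjunct2, THEN conjunct2, THEN conjunct2, rule_format]; assumption)
qed

text \<open>What remains of the invariant once the root is processed. Only the part of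
  \<open>r0\<close> may be light; \<open>r0\<close> may lie outside the roots, which covers the case
  without a light part. The condition on \<open>f\<close> serves the labelling pass.\<close>

definition part_inv :: "(nat \<Rightarrow> nat) \<Rightarrow> (nat \<Rightarrow> nat) \<Rightarrow> (nat \<Rightarrow> nat set) \<Rightarrow> bool" where
  "part_inv f mark T \<longleftrightarrow>
     disjoint_family_on T (roots 0 mark) \<and> (\<Union>r\<in>roots 0 mark. T r) = {..<n} \<and>
     (\<forall>r\<in>roots 0 mark. r \<in> T r \<and> connected_graph (induced G (T r)) \<and> sum w (T r) \<le> (c - 1) * lam \<and>
        (\<forall>u\<in>T r. u \<noteq> r \<longrightarrow> f u \<in> T r \<and> f u \<in> A u \<and> f u \<noteq> u)) \<and>
     (\<exists>r0. \<forall>r\<in>roots 0 mark. r \<noteq> r0 \<longrightarrow> lam \<le> sum w (T r))"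

lemma bag_inv_init:
  assumes "\<And>v. v < n \<Longrightarrow> sub v = w v"
  shows "bag_inv n par sub (\<lambda>_. 0) (\<lambda>v. {v})"
proof -
  have "roots n (\<lambda>_. 0) = {..<n}" unfolding roots_def onto by auto
  moreover from this have "kids n par (\<lambda>_. 0) v = {}" for v unfolding kids_def by auto
  moreover have "connected_graph (induced G {v})" if "v < n" for v
    using that V by (intro connected_induced_singleton) auto
  ultimately show ?thesis
    unfolding bag_inv_def onto using A_refl assms by (auto simp: disjoint_family_on_def)
qed

end

section \<open>Processing one vertex\<close>

locale bag_step = dfs_tree +
  fixes i :: nat and f sub mark :: "nat \<Rightarrow> nat" and T :: "nat \<Rightarrow> nat set" and v :: nat
  assumes inv: "bag_inv (Suc i) f sub mark T" and i_less: "i < n" and v_def: "v = ord i"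
begin

abbreviation "R \<equiv> roots (Suc i) mark"
abbreviation "R' \<equiv> roots i mark"
abbreviation "K \<equiv> kids (Suc i) f mark"

lemma U_Suc: "ord ` {..<Suc i} = insert v (ord ` {..<i})"
  by (auto simp: v_def lessThan_Suc)

lemma v_notin: "v \<notin> ord ` {..<i}"
  using ord_inj i_less by (auto simp: v_def)

lemma v_less: "v < n"
  using ord_less i_less v_def by simp

lemma top_v: "mark v = 0"
  using bag_invD(2)[OF inv] U_Suc by simp

lemma f_v: "f v = par v"
  using bag_invD(1)[OF inv] U_Suc by simp

text \<open>\<open>R'\<close> is the set of roots if \<open>v\<close> is passed on unmarked; if
  \<open>v\<close> is marked, the roots stay \<open>R\<close>.\<close>

lemma R_Suc: "R = insert v R'" "v \<notin> R'"
  unfolding roots_def U_Suc using v_notin top_v by auto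

lemma R_less: "r \<in> R \<Longrightarrow> r < n"
  using i_less ord_less unfolding roots_def by auto

lemma finite_T: "u < n \<Longrightarrow> finite (T u)"
  using bag_invD(4)[OF inv, of u] finite_subset[of "T u" "{..<n}"] by auto

lemma T_disjoint: "r \<in> R \<Longrightarrow> s \<in> R \<Longrightarrow> r \<noteq> s \<Longrightarrow> T r \<inter> T s = {}"
  using bag_invD(8)[OF inv] unfolding disjoint_family_on_def by blast

lemma K_facts:
  assumes "u \<in> K x"
  shows "u < n" "u \<notin> R" "f u = x" "x \<in> A u" "x \<noteq> u" "adj x u" "sub u < lam"
  using assms bag_invD(11)[OF inv, of u] unfolding kids_def by auto

lemma K_incomparable: "x \<in> ord ` {..<Suc i} \<Longrightarrow> u \<in> K x \<Longrightarrow> u' \<in> K x \<Longrightarrow> u \<noteq> u' \<Longrightarrow> u \<notin> A u'"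
  using bag_invD(14)[OF inv] .

lemma v_in: "v \<in> ord ` {..<Suc i}"
  using U_Suc by simp

text \<open>The ancestors of \<open>y\<close> form a chain, the kids of \<open>v\<close> an
  antichain.\<close>

lemma K_unique:
  assumes "u \<in> K v" "u' \<in> K v" "y < n" "u \<in> A y" "u' \<in> A y"
  shows "u = u'"
  using A_linear[OF assms(3-5)] K_incomparable[OF v_in assms(1,2)] K_incomparable[OF v_in assms(2,1)]
  by blast

lemma K_nonadj: "u \<in> K v \<Longrightarrow> u' \<in> K v \<Longrightarrow> \<not> adj u u'"
  using K_incomparable[OF v_in, of u u'] K_incomparable[OF v_in, of u' u] A_edge[of u u'] adj_irrefl
  by auto

lemma K_disjoint: "u \<in> K v \<Longrightarrow> u' \<in> K v \<Longrightarrow> u \<noteq> u' \<Longrightarrow> T u \<inter> T u' = {}"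
proof (rule ccontr)
  assume u: "u \<in> K v" "u' \<in> K v" "u \<noteq> u'" and "T u \<inter> T u' \<noteq> {}"
  then obtain x where x: "x \<in> T u" "x \<in> T u'" by blast
  then have "u \<in> A x" "u' \<in> A x" "x < n"
    using bag_invD(4,5)[OF inv K_facts(1)] u by blast+
  then show False
    using K_unique u by blast
qed

lemma v_notin_T: "u \<in> K v \<Longrightarrow> v \<notin> T u"
  using bag_invD(5)[OF inv, of u v] A_antisym[of u v] K_facts[of u v] by auto

lemma T_v: "T v = insert v (\<Union>u\<in>K v. T u)"
  using bag_invD(12)[OF inv, of v] U_Suc by simp

lemma finite_K: "finite (K x)"
  unfolding kids_def by simp

lemma card_K: "card (K v) < c"
proof (rule claw_free_card[OF simple claw])
  show "{v, x} \<in> edges G" if "x \<in> K v" for x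
    using K_facts(6)[OF that] by (simp add: adj_def)
  show "{x, y} \<notin> edges G" if "x \<in> K v" "y \<in> K v" for x y
    using K_nonadj[OF that] by (simp add: adj_def)
  show "v \<in> verts G"
    using v_less V by simp
qed

lemma sum_T:
  assumes "J \<subseteq> K v"
  shows "sum w (insert v (\<Union>u\<in>J. T u)) = w v + sum sub J"
proof -
  have fin: "finite J" using assms finite_K finite_subset by blast
  have "sum w (\<Union>u\<in>J. T u) = (\<Sum>u\<in>J. sum w (T u))"
    by (intro sum.UNION_disjoint) (use fin assms K_disjoint K_facts(1) finite_T in \<open>blast+\<close>)
  also have "\<dots> = sum sub J"
    using bag_invD(7)[OF inv] K_facts(1) assms by (intro sum.cong) auto
  finally have "sum w (\<Union>u\<in>J. T u) = sum sub J" .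
  moreover have "v \<notin> (\<Union>u\<in>J. T u)"
    using v_notin_T assms by blast
  moreover have "finite (\<Union>u\<in>J. T u)"
    using fin finite_T K_facts(1) assms by blast
  ultimately show ?thesis by simp
qed

lemma sum_sub_le:
  assumes "J \<subseteq> K v"
  shows "w v + sum sub J \<le> Suc (card J) * lam"
proof -
  have "sub u \<le> lam" if "u \<in> J" for u
    using K_facts(7)[of u v] assms that by auto
  then have "sum sub J \<le> card J * lam"
    using sum_bounded_above[of J sub lam] by simp
  then show ?thesis using w_le_lam[OF v_less] by simp
qed

text \<open>With at most \<open>c - 2\<close> kids the bag would consist of at most
  \<open>c - 1\<close> pieces, \<open>v\<close> included, each of weight at most
  \<open>lam\<close>.\<close>

lemma heavy_card:
  assumes "(c - 1) * lam < sub v"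
  shows "card (K v) = c - 1"
proof (rule ccontr)
  assume "card (K v) \<noteq> c - 1"
  then have "Suc (card (K v)) \<le> c - 1" using card_K by simp
  then have "Suc (card (K v)) * lam \<le> (c - 1) * lam" by (rule mult_le_mono1)
  moreover have "sub v = w v + sum sub (K v)"
    using bag_invD(7)[OF inv v_less] sum_T[of "K v"] T_v by simp
  ultimately show False using assms sum_sub_le[of "K v"] by simp
qed

text \<open>Justifies the test for kids in the scan. A finished vertex fails it through its mark. An
  unprocessed vertex other than \<open>0\<close> still points to its tree parent, which was
  discovered before \<open>v\<close>. Since \<open>par 0 = 0\<close> makes the root its own parent,
  \<open>v\<close> has to be marked before the scan.\<close>

lemma kid_iff:
  assumes "u < n" "f u = v" "(mark(v := 1)) u = 0"
  shows "u \<in> K v"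
proof -
  have "u \<noteq> v" "mark u = 0" using assms by (auto split: if_splits)
  have "u \<notin> ord ` {..<i}"
  proof
    assume "u \<in> ord ` {..<i}"
    then obtain l where l: "l < i" "u = ord l" by auto
    have "f u = par u" using bag_invD(1)[OF inv, of u] l by auto
    then have "par u = v" using assms by simp
    moreover have "u \<noteq> 0" using \<open>par u = v\<close> \<open>u \<noteq> v\<close> par_0 by metis
    then obtain j where "j < l" "par u = ord j" using par_ord[of l] l i_less ord_0 by (metis gr0I less_trans)
    ultimately show False using v_notin l by auto
  qed
  then show ?thesis
    unfolding kids_def using R_Suc assms(1,2) \<open>mark u = 0\<close> \<open>u \<noteq> v\<close> by (auto simp: roots_def)
qed

lemma ex_heavy_kid:
  assumes "(c - 1) * lam < sub v"
  shows "\<exists>u\<in>K v. adj (par v) u"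
proof (cases "v = 0")
  case True
  \<comment> \<open>The root is its own parent, so every kid is adjacent to the parent and the
    program can treat the root like any other vertex.\<close>
  have "K v \<noteq> {}" using heavy_card[OF assms] c_ge by auto
  then show ?thesis using True par_0 K_facts(6) by fastforce
next
  case False
  show ?thesis
  proof (rule ccontr)
    assume no: "\<not> ?thesis"
    note p = par_facts[OF v_less False]
    \<comment> \<open>The parent lies above \<open>v\<close> and the kids lie below, so the parent
      supplies a \<open>c\<close>-th leaf.\<close>
    have "par v \<notin> K v"
      using p A_antisym[of "par v" v] v_less K_facts(4) by blast
    then have "card (insert (par v) (K v)) = c"
      using finite_K heavy_card[OF assms] c_ge by simp
    moreover have "card (insert (par v) (K v)) < c"
    proof (rule claw_free_card[OF simple claw])
      show "{v, x} \<in> edges G" if "x \<in> insert (par v) (K v)" for x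
        using K_facts(6)[of x v] p adj_sym that unfolding adj_def by auto
      show "{x, y} \<notin> edges G" if "x \<in> insert (par v) (K v)" "y \<in> insert (par v) (K v)" for x y
        using K_nonadj[of x y] no that adj_irrefl adj_sym unfolding adj_def[symmetric] by auto
      show "v \<in> verts G"
        using v_less V by simp
    qed
    ultimately show False by simp
  qed
qed

lemma T_K_subset: "u \<in> K v \<Longrightarrow> T u \<subseteq> T v"
  using T_v by auto

lemma T_v_diff:
  assumes "u \<in> K v"
  shows "T v - T u = insert v (\<Union>x\<in>K v - {u}. T x)"
  using K_disjoint[OF _ assms] v_notin_T[OF assms] T_v by auto

lemma sum_T_diff: "u \<in> K v \<Longrightarrow> sum w (T v - T u) = sub v - sub u"
  using sum_diff_nat[of "T u" "T v" w] finite_T[of u] K_facts(1) T_K_subset bag_invD(7)[OF inv] v_less by metis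

lemma connected_T_diff:
  assumes "u \<in> K v"
  shows "connected_graph (induced G (T v - T u))"
proof -
  have "connected_graph (induced G (insert v (\<Union>x\<in>K v - {u}. T x)))"
  proof (rule connected_induced_insert_UN)
    fix x assume "x \<in> K v - {u}"
    then have x: "x \<in> K v" by auto
    then show "{v, x} \<in> edges G \<and> x \<in> T x \<and> T x \<subseteq> verts G \<and> connected_graph (induced G (T x))"
      using K_facts(1,6)[OF x] bag_invD(3,4,6)[OF inv, of x] V unfolding adj_def by auto
  qed (use v_less V in simp)
  then show ?thesis using T_v_diff[OF assms] by simp
qed

lemma heavy_split:
  assumes "(c - 1) * lam < sub v" "u \<in> K v"
  shows "lam \<le> sub v - sub u" "sub v - sub u \<le> (c - 1) * lam"
proof -
  have "2 * lam \<le> (c - 1) * lam" using c_ge by (intro mult_le_mono1) simp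
  then have "2 * lam < sub v" using assms(1) by linarith
  then show "lam \<le> sub v - sub u" using K_facts(7)[OF assms(2)] by linarith
  have "sub v - sub u = w v + sum sub (K v - {u})"
    using sum_T_diff[OF assms(2)] T_v_diff[OF assms(2)] sum_T[of "K v - {u}"] by auto
  also have "\<dots> \<le> Suc (card (K v - {u})) * lam"
    by (rule sum_sub_le) auto
  also have "Suc (card (K v - {u})) = c - 1"
    using heavy_card[OF assms(1)] assms(2) finite_K c_ge by simp
  finally show "sub v - sub u \<le> (c - 1) * lam" .
qed

text \<open>Below \<open>v\<close> the map \<open>f\<close> does not leave the bag of a child: its values stay among the
  ancestors, which lie in no other child's bag.\<close>

lemma f_in_diff:
  assumes u: "u \<in> K v" and x: "x \<in> T v - T u" "x \<noteq> v"
  shows "f x \<in> T v - T u"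
proof -
  have vR: "v \<in> R" using R_Suc by simp
  have fx: "f x \<in> T v" using bag_invD(10)[OF inv vR] x by auto
  obtain u' where u': "u' \<in> K v" "x \<in> T u'" "u' \<noteq> u"
    using x T_v_diff[OF u] by auto
  have xn: "x < n" using bag_invD(4)[OF inv v_less] x by auto
  have "x \<notin> R" using T_disjoint[OF vR, of x] bag_invD(3)[OF inv xn] x by auto
  then have fA: "f x \<in> A x" using bag_invD(11)[OF inv xn] by simp
  have "f x \<notin> T u"
  proof
    assume "f x \<in> T u"
    then have "u \<in> A (f x)" using bag_invD(5)[OF inv] K_facts(1)[OF u] by blast
    then have "u \<in> A x" using A_trans xn fA by blast
    moreover have "u' \<in> A x" using bag_invD(5)[OF inv] K_facts(1)[OF u'(1)] u'(2) by blast
    ultimately show False using K_unique[OF u u'(1) xn] u'(3) by blast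
  qed
  then show ?thesis using fx by simp
qed

lemma f_in_kid:
  assumes u: "u \<in> K v" and x: "x \<in> T u" "x \<noteq> u"
  shows "f x \<in> T u"
proof -
  have vR: "v \<in> R" using R_Suc by simp
  have xv: "x \<in> T v" "x \<noteq> v" using x u T_K_subset v_notin_T by auto
  have fx: "f x \<in> T v" using bag_invD(10)[OF inv vR] xv by auto
  have xn: "x < n" using bag_invD(4)[OF inv v_less] xv by auto
  have xR: "x \<notin> R" using T_disjoint[OF vR, of x] bag_invD(3)[OF inv xn] xv by auto
  then have fA: "f x \<in> A x" using bag_invD(11)[OF inv xn] by simp
  have uA: "u \<in> A x" using bag_invD(5)[OF inv] K_facts(1)[OF u] x by blast
  show ?thesis
  proof (rule ccontr)
    assume "f x \<notin> T u"
    then consider "f x = v" | u' where "u' \<in> K v" "f x \<in> T u'" "u' \<noteq> u"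
      using fx T_v by auto
    then show False
    proof cases
      case 1
      \<comment> \<open>If \<open>f\<close> led from \<open>x\<close> straight to \<open>v\<close>,
        then \<open>x\<close> would be a kid of \<open>v\<close> below the kid
        \<open>u\<close>.\<close>
      then have "x \<in> K v" using xn xR unfolding kids_def by auto
      then show False using K_incomparable[OF v_in u, of x] x uA by auto
    next
      case 2
      then have "u' \<in> A (f x)" using bag_invD(5)[OF inv] K_facts(1) by blast
      then have "u' \<in> A x" using A_trans xn fA by blast
      then show False using K_unique[OF u 2(1) xn uA] 2(3) by blast
    qed
  qed
qed

text \<open>A vertex below \<open>v\<close> is incomparable with everything already hanging below the parent of
  \<open>v\<close>, since that hangs below other children of the parent.\<close>

lemma below_incomparable:
  assumes "v \<noteq> 0" "u \<in> K (par v)" "y < n" "v \<in> A y"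
  shows "u \<notin> A y" "y \<notin> A u"
proof -
  note p = par_facts[OF v_less \<open>v \<noteq> 0\<close>]
  obtain j where j: "j < i" "par v = ord j"
    using par_ord[of i] i_less v_def \<open>v \<noteq> 0\<close> ord_0 by (metis gr0I)
  have pU: "par v \<in> ord ` {..<Suc i}" using j by auto
  note u = K_facts[OF assms(2)]
  have uv: "v \<notin> A u"
    using bag_invD(13)[OF inv pU assms(2), of v] p U_Suc by auto
  have "u \<noteq> v" using u(2) R_Suc by auto
  then have vu: "u \<notin> A v"
    using p u A_antisym[of u "par v"] by auto
  show "u \<notin> A y" using A_linear[OF assms(3)] assms(4) uv vu by blast
  show "y \<notin> A u" using A_trans[OF u(1)] assms(4) uv by blast
qed

lemma par_in_U:
  assumes "v \<noteq> 0"
  shows "par v \<in> ord ` {..<i}"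
  using par_ord[of i] i_less v_def assms ord_0 by (metis gr0I image_eqI lessThan_iff)

text \<open>Marking keeps \<open>v\<close> a root, now of a finished part, so roots, kids and bags
  remain the same sets.\<close>

lemma full_step:
  assumes "lam \<le> sub v" "sub v \<le> (c - 1) * lam"
  shows "bag_inv i f sub (mark(v := 1)) T"
proof -
  have R: "roots i (mark(v := 1)) = R"
    unfolding roots_def U_Suc using v_less by auto
  then have K: "kids i f (mark(v := 1)) = K"
    unfolding kids_def by auto
  have U: "x \<in> ord ` {..<Suc i}" if "x \<in> ord ` {..<i}" for x
    using that U_Suc by simp
  have 1: "f x = par x \<and> (mark(v := 1)) x = 0" if "x \<in> ord ` {..<i}" for x
    using bag_invD(1,2)[OF inv U[OF that]] that v_notin by auto
  have 2: "x \<in> T x \<and> (\<forall>y\<in>T x. y < n \<and> x \<in> A y) \<and> connected_graph (induced G (T x)) \<and> sub x = sum w (T x)"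
    if "x < n" for x
    using bag_invD(3-7)[OF inv that] by simp
  have 3: "y \<notin> ord ` {..<i}"
    if "x \<in> ord ` {..<i}" "u \<in> K x" "y \<in> A u" "x \<in> A y" "y \<noteq> x" for x u y
    using bag_invD(13)[OF inv U[OF that(1)] that(2-)] U by blast
  have 4: "lam \<le> sub x \<and> sub x \<le> (c - 1) * lam" if "x < n" "(mark(v := 1)) x \<noteq> 0" for x
    using bag_invD(15)[OF inv that(1)] that assms by (cases "x = v") auto
  show ?thesis
    unfolding bag_inv_def R K
    by (intro conjI; (intro allI ballI impI)?;
      (rule 1 2 3 4 bag_invD(8-11)[OF inv] bag_invD(12,14)[OF inv U]; assumption))
qed

text \<open>The delicate clauses concern \<open>p\<close>, which gains the kid \<open>v\<close>: no
  tree vertex lies strictly between \<open>p\<close> and \<open>v\<close>, and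
  \<open>below_incomparable\<close> preserves the antichain.\<close>

lemma light_step:
  assumes light: "sub v < lam" and "v \<noteq> 0"
  defines "p \<equiv> par v"
  shows "bag_inv i f (sub(p := sub p + sub v)) mark (T(p := T p \<union> T v))"
proof -
  let ?T = "T(p := T p \<union> T v)" and ?sub = "sub(p := sub p + sub v)"
  note p = par_facts[OF v_less \<open>v \<noteq> 0\<close>, folded p_def]
  have pU: "p \<in> ord ` {..<i}" using par_in_U \<open>v \<noteq> 0\<close> p_def by simp
  then have pR: "p \<in> R'" unfolding roots_def by simp
  have pR2: "p \<in> R" "v \<in> R" using pR R_Suc by auto
  have disj: "T p \<inter> T v = {}" using T_disjoint pR2 p by blast
  have K: "kids i f mark x = (if x = p then insert v (K p) else K x)" for x
    unfolding kids_def R_Suc(1) using R_Suc(2) f_v v_less p_def by auto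
  have TK: "?T u = T u" if "u \<notin> R'" for u
    using that pR by auto
  have 2: "x \<in> ?T x \<and> (\<forall>y\<in>?T x. y < n \<and> x \<in> A y) \<and> connected_graph (induced G (?T x)) \<and> ?sub x = sum w (?T x)"
    if "x < n" for x
  proof (cases "x = p")
    case True
    have "connected_graph (induced G (T p \<union> T v))"
      using bag_invD(3,4,6)[OF inv p(1)] bag_invD(3,4,6)[OF inv v_less] p(2) V unfolding adj_def
      by (intro connected_induced_Un[of G _ _ p v]) auto
    moreover have "sum w (T p \<union> T v) = sub p + sub v"
      using disj finite_T p v_less bag_invD(7)[OF inv] by (subst sum.union_disjoint) auto
    moreover have "T v \<subseteq> {y. y < n \<and> p \<in> A y}"
      using bag_invD(4,5)[OF inv v_less] A_trans p(5) by blast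
    ultimately show ?thesis using True bag_invD(3-5)[OF inv p(1)] by auto
  next
    case False
    then show ?thesis using bag_invD(3-7)[OF inv that] by auto
  qed
  have 3: "disjoint_family_on ?T R'" "(\<Union>r\<in>R'. ?T r) = {..<n}"
    using disjoint_family_on_absorb[of T v R' p] bag_invD(8,9)[OF inv] R_Suc pR by auto
  have 4: "f u \<in> ?T r" if "r \<in> R'" "u \<in> ?T r" "u \<noteq> r" for r u
  proof (cases "r = p \<and> u \<in> T v")
    case True
    then show ?thesis
      using bag_invD(10)[OF inv pR2(2), of u] bag_invD(3)[OF inv p(1)] f_v p_def by (cases "u = v") auto
  next
    case False
    then show ?thesis using bag_invD(10)[OF inv, of r u] that R_Suc by (auto split: if_splits)
  qed
  have 5: "f u < n \<and> f u \<in> A u \<and> f u \<noteq> u \<and> adj (f u) u \<and> ?sub u < lam" if "u < n" "u \<notin> R'" for u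
  proof (cases "u = v")
    case True
    then show ?thesis using p f_v light p_def by auto
  next
    case False
    then have "u \<notin> R" "u \<noteq> p" using that R_Suc pR by auto
    then show ?thesis using bag_invD(11)[OF inv that(1)] by auto
  qed
  have 6: "?T x = insert x (\<Union>u\<in>kids i f mark x. ?T u)" if "x \<in> ord ` {..<i}" for x
  proof -
    have "T x = insert x (\<Union>u\<in>K x. T u)" using bag_invD(12)[OF inv, of x] that U_Suc by auto
    moreover have "(\<Union>u\<in>kids i f mark x. ?T u) = (\<Union>u\<in>kids i f mark x. T u)"
      by (rule SUP_cong) (use TK in \<open>auto simp: kids_def\<close>)
    ultimately show ?thesis using K by auto
  qed
  have 7: "y \<notin> ord ` {..<i}"
    if "x \<in> ord ` {..<i}" "u \<in> kids i f mark x" "y \<in> A u" "x \<in> A y" "y \<noteq> x" for x u y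
  proof (cases "u = v")
    case True
    then have "x = p" using that f_v p_def unfolding kids_def by auto
    then have "y = v" using that True p A_antisym[of p y] by auto
    then show ?thesis using v_notin by simp
  next
    case False
    then have "u \<in> K x" using that K by (auto split: if_splits)
    then show ?thesis using bag_invD(13)[OF inv, of x u y] that U_Suc by auto
  qed
  have 8: "u \<notin> A u'"
    if "x \<in> ord ` {..<i}" "u \<in> kids i f mark x" "u' \<in> kids i f mark x" "u \<noteq> u'" for x u u'
    using that below_incomparable[OF \<open>v \<noteq> 0\<close>, of u v] below_incomparable[OF \<open>v \<noteq> 0\<close>, of u' v]
      A_refl[OF v_less] v_less K K_incomparable[of x u u'] U_Suc p_def by (auto split: if_splits)
  have 9: "lam \<le> ?sub x \<and> ?sub x \<le> (c - 1) * lam" if "x < n" "mark x \<noteq> 0" for x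
    using bag_invD(15)[OF inv that] bag_invD(2)[OF inv, of p] pU U_Suc that by auto
  have 1: "f x = par x \<and> mark x = 0" if "x \<in> ord ` {..<i}" for x
    using bag_invD(1,2)[OF inv, of x] that U_Suc by auto
  show ?thesis
    unfolding bag_inv_def 
    by (intro conjI; (intro allI ballI impI)?; (rule 1 2 3 4 5 6 7 8 9; assumption))
qed

text \<open>The new kid \<open>u\<close> of \<open>p\<close> may lie several tree edges below
  \<open>v\<close>. The path clause at \<open>p\<close> therefore draws on the one at
  \<open>v\<close>, and the antichain clause on \<open>below_incomparable\<close>.\<close>

lemma heavy_step:
  assumes heavy: "(c - 1) * lam < sub v" and "v \<noteq> 0" and u: "u \<in> K v" "adj (par v) u"
  defines "p \<equiv> par v"
  shows "bag_inv i (f(u := p)) (sub(v := sub v - sub u, p := sub p + sub u)) (mark(v := 1))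
    (T(v := T v - T u, p := T p \<union> T u))"
proof -
  let ?T = "T(v := T v - T u, p := T p \<union> T u)" and ?mark = "mark(v := 1)" and ?f = "f(u := p)"
  let ?sub = "sub(v := sub v - sub u, p := sub p + sub u)"
  note p = par_facts[OF v_less \<open>v \<noteq> 0\<close>, folded p_def]
  note uf = K_facts[OF u(1)]
  have pU: "p \<in> ord ` {..<i}" using par_in_U \<open>v \<noteq> 0\<close> p_def by simp
  have pR: "p \<in> R" "v \<in> R" using pU R_Suc unfolding roots_def by auto
  have R: "roots i ?mark = R"
    unfolding roots_def U_Suc using v_less by auto
  have disj: "T p \<inter> T v = {}" using T_disjoint pR p by blast
  have pu: "p \<in> A u" using A_trans[OF uf(1,4)] p(5) .
  have "p \<noteq> u" using uf(2) pR by auto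
  have K: "kids i ?f ?mark x = (if x = p then insert u (K p) else K x)" if "x \<noteq> v" for x
    unfolding kids_def R using uf that by auto
  have TK: "?T x = T x" if "x \<notin> R" for x
    using that pR by auto
  have 2: "x \<in> ?T x \<and> (\<forall>y\<in>?T x. y < n \<and> x \<in> A y) \<and> connected_graph (induced G (?T x)) \<and> ?sub x = sum w (?T x)"
    if "x < n" for x
  proof -
    consider "x = p" | "x = v" | "x \<noteq> p" "x \<noteq> v" by blast
    then show ?thesis
    proof cases
      case 1
      have "connected_graph (induced G (T p \<union> T u))"
        using bag_invD(3,4,6)[OF inv p(1)] bag_invD(3,4,6)[OF inv uf(1)] u(2) V
        unfolding adj_def p_def[symmetric] by (intro connected_induced_Un[of G _ _ p u]) auto
      moreover have "T p \<inter> T u = {}" using disj T_K_subset[OF u(1)] by auto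
      then have "sum w (T p \<union> T u) = sub p + sub u"
        using finite_T p(1) uf(1) bag_invD(7)[OF inv] by (subst sum.union_disjoint) auto
      moreover have "T u \<subseteq> {y. y < n \<and> p \<in> A y}"
        using bag_invD(4,5)[OF inv uf(1)] A_trans pu by blast
      ultimately show ?thesis using 1 bag_invD(3-5)[OF inv p(1)] by auto
    next
      case 2
      then show ?thesis
        using p(6) bag_invD(3-5)[OF inv v_less] v_notin_T[OF u(1)] connected_T_diff[OF u(1)] sum_T_diff[OF u(1)]
        by auto
    next
      case 3
      then show ?thesis using bag_invD(3-7)[OF inv that] by auto
    qed
  qed
  have 3: "disjoint_family_on ?T R" "(\<Union>r\<in>R. ?T r) = {..<n}"
    using disjoint_family_on_move[of T R p v "T u"] bag_invD(8,9)[OF inv] pR p(6) T_K_subset[OF u(1)] by auto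
  have uT: "u \<in> T u" using bag_invD(3)[OF inv uf(1)] .
  have 4: "?f x \<in> ?T r" if rx: "r \<in> R" "x \<in> ?T r" "x \<noteq> r" for r x
  proof -
    consider "r = v" | "r = p" "x \<in> T u" | "r \<noteq> v" "x \<in> T r"
      using rx by (auto split: if_splits)
    then show ?thesis
    proof cases
      case 1
      then show ?thesis using f_in_diff[OF u(1), of x] rx p(6) uT by auto
    next
      case 2
      then show ?thesis using f_in_kid[OF u(1), of x] bag_invD(3)[OF inv p(1)] by auto
    next
      case 3
      then have "x \<noteq> u" using T_disjoint[OF rx(1) pR(2)] T_K_subset[OF u(1)] uT by auto
      then show ?thesis using bag_invD(10)[OF inv rx(1) 3(2) rx(3)] 3 by auto
    qed
  qed
  have 5: "?f x < n \<and> ?f x \<in> A x \<and> ?f x \<noteq> x \<and> adj (?f x) x \<and> ?sub x < lam" if "x < n" "x \<notin> R" for x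
  proof -
    have "x \<noteq> v" "x \<noteq> p" using that pR by auto
    then show ?thesis using bag_invD(11)[OF inv that] p(1) pu \<open>p \<noteq> u\<close> u(2) p_def by auto
  qed
  have 6: "?T x = insert x (\<Union>u\<in>kids i ?f ?mark x. ?T u)" if "x \<in> ord ` {..<i}" for x
  proof -
    have "x \<noteq> v" using that v_notin by auto
    have Tx: "T x = insert x (\<Union>u\<in>K x. T u)" using bag_invD(12)[OF inv, of x] that U_Suc by auto
    have "?T x = insert x (\<Union>u\<in>kids i ?f ?mark x. T u)"
    proof (cases "x = p")
      case True
      then have "?T x = T u \<union> T x" by auto
      also have "\<dots> = insert x (\<Union>y\<in>insert u (K x). T y)" by (subst Tx) auto
      finally show ?thesis using K[OF \<open>x \<noteq> v\<close>] True by simp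
    next
      case False
      then show ?thesis using K[OF \<open>x \<noteq> v\<close>] \<open>x \<noteq> v\<close> Tx by simp
    qed
    also have "(\<Union>u\<in>kids i ?f ?mark x. T u) = (\<Union>u\<in>kids i ?f ?mark x. ?T u)"
      by (rule SUP_cong) (use TK R in \<open>auto simp: kids_def\<close>)
    finally show ?thesis .
  qed
  have 7: "y \<notin> ord ` {..<i}"
    if "x \<in> ord ` {..<i}" "x' \<in> kids i ?f ?mark x" "y \<in> A x'" "x \<in> A y" "y \<noteq> x" for x x' y
  proof (cases "x' = u")
    case True
    have "x \<noteq> v" using that v_notin by auto
    have "x = p" using that True unfolding kids_def by auto
    \<comment> \<open>The tree path from \<open>p\<close> to \<open>u\<close> is split at
      \<open>v\<close>: below \<open>v\<close> the path clause of \<open>v\<close> applies, and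
      above \<open>v\<close> there is only \<open>p\<close>.\<close>
    from A_linear[OF uf(1,4), of y] that True have "v \<in> A y \<or> y \<in> A v" by auto
    then show ?thesis
    proof
      assume "v \<in> A y"
      then show ?thesis
        using bag_invD(13)[OF inv _ u(1), of y] that True U_Suc v_notin by (cases "y = v") auto
    next
      assume "y \<in> A v"
      then have "y = v \<or> y \<in> A p" using p(3) by auto
      then show ?thesis using v_notin A_antisym[OF p(1), of y] that \<open>x = p\<close> by auto
    qed
  next
    case False
    have "x \<noteq> v" using that v_notin by auto
    then have "x' \<in> K x" using that K False by (auto split: if_splits)
    then show ?thesis using bag_invD(13)[OF inv, of x x' y] that U_Suc by auto
  qed
  have 8: "y \<notin> A y'"
    if "x \<in> ord ` {..<i}" "y \<in> kids i ?f ?mark x" "y' \<in> kids i ?f ?mark x" "y \<noteq> y'" for x y y'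
  proof -
    have "x \<noteq> v" using that v_notin by auto
    \<comment> \<open>As \<open>u\<close> lies below \<open>v\<close>, it is incomparable with all
      earlier kids of \<open>p\<close>.\<close>
    note b = below_incomparable[OF \<open>v \<noteq> 0\<close> _ uf(1,4), folded p_def]
    show ?thesis
      using that b[of y] b[of y'] K[OF \<open>x \<noteq> v\<close>] K_incomparable[of x y y'] U_Suc
      by (auto split: if_splits)
  qed
  have 9: "lam \<le> ?sub x \<and> ?sub x \<le> (c - 1) * lam" if "x < n" "?mark x \<noteq> 0" for x
    using bag_invD(15)[OF inv that(1)] bag_invD(2)[OF inv, of p] pU U_Suc that p(6)
      heavy_split[OF heavy u(1)] by (auto split: if_splits)
  have 1: "?f x = par x \<and> ?mark x = 0" if "x \<in> ord ` {..<i}" for x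
    using bag_invD(1,2)[OF inv, of x] that U_Suc v_notin uf(2) unfolding roots_def by auto
  show ?thesis
    unfolding bag_inv_def R 
    by (intro conjI; (intro allI ballI impI)?; (rule 1 2 3 4 5 6 7 8 9; assumption))
qed

end

context dfs_tree
begin

lemma bag_inv_part_inv:
  assumes "bag_inv 0 f sub mark T"
  shows "part_inv f mark T"
proof -
  note D = bag_invD[OF assms]
  have less: "r < n" if "r \<in> roots 0 mark" for r
    using that unfolding roots_def by auto
  have "u \<notin> roots 0 mark" if r: "r \<in> roots 0 mark" and u: "u \<in> T r" "u \<noteq> r" for r u
    using D(8) r u D(3)[OF D(4)[OF less[OF r] u(1)]] unfolding disjoint_family_on_def by blast
  then have "f u \<in> A u \<and> f u \<noteq> u" if "r \<in> roots 0 mark" "u \<in> T r" "u \<noteq> r" for r u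
    using D(11)[OF D(4)[OF less[OF that(1)] that(2)]] that by blast
  moreover have "lam \<le> sum w (T r) \<and> sum w (T r) \<le> (c - 1) * lam" if "r \<in> roots 0 mark" for r
    using D(15)[of r] D(7)[of r] that unfolding roots_def by auto
  ultimately have "\<forall>r\<in>roots 0 mark. r \<in> T r \<and> connected_graph (induced G (T r)) \<and>
      sum w (T r) \<le> (c - 1) * lam \<and> (\<forall>u\<in>T r. u \<noteq> r \<longrightarrow> f u \<in> T r \<and> f u \<in> A u \<and> f u \<noteq> u)"
    "\<exists>r0. \<forall>r\<in>roots 0 mark. r \<noteq> r0 \<longrightarrow> lam \<le> sum w (T r)"
    using D(3,6)[OF less] D(10) by simp_all
  then show ?thesis
    unfolding part_inv_def by (intro conjI D(8,9))
qed

end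

context bag_step
begin

text \<open>The two cases that produce a light part, owned by \<open>v\<close> itself or by the
  cut-out kid \<open>u\<close>. The third case at the root is \<open>full_step\<close> followed by
  \<open>bag_inv_part_inv\<close>.\<close>

lemma root_step:
  assumes "v = 0"
  shows "sub v < lam \<Longrightarrow> part_inv f (mark(v := 1)) T"
    and "(c - 1) * lam < sub v \<Longrightarrow> u \<in> K v \<Longrightarrow> part_inv (f(u := par v)) (mark(v := 1, u := 1)) (T(v := T v - T u))"
proof -
  have i: "i = 0" using assms ord_eq_0 i_less v_def by simp
  have R: "roots 0 (mark(v := 1)) = R"
    unfolding roots_def U_Suc using v_less i by auto
  have nR: "x \<notin> R" if "r \<in> R" "x \<in> T r" "x \<noteq> r" for r x
    using T_disjoint[OF that(1), of x] that bag_invD(3)[OF inv, of x] bag_invD(4)[OF inv R_less[OF that(1)] that(2)] by auto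
  have f: "f x \<in> T r \<and> f x \<in> A x \<and> f x \<noteq> x" if "r \<in> R" "x \<in> T r" "x \<noteq> r" for r x
    using bag_invD(10)[OF inv that] nR[OF that] bag_invD(11)[OF inv bag_invD(4)[OF inv R_less[OF that(1)] that(2)]]
    by auto
  have tops: "lam \<le> sum w (T r)" "sum w (T r) \<le> (c - 1) * lam" if "r \<in> R" "r \<noteq> v" for r
    using bag_invD(15)[OF inv, of r] bag_invD(7)[OF inv, of r] that i v_def unfolding roots_def by auto
  have "1 \<le> c - 1" using c_ge by simp
  then have c1: "lam \<le> (c - 1) * lam" by (metis mult_1 mult_le_mono1)
  show "part_inv f (mark(v := 1)) T" if "sub v < lam"
  proof -
    have "sum w (T r) \<le> (c - 1) * lam" if "r \<in> R" for r
      using tops(2)[OF that] bag_invD(7)[OF inv v_less] less_imp_le[OF \<open>sub v < lam\<close>] c1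
      by (metis le_trans)
    then have a: "\<forall>r\<in>R. r \<in> T r \<and> connected_graph (induced G (T r)) \<and> sum w (T r) \<le> (c - 1) * lam \<and>
        (\<forall>x\<in>T r. x \<noteq> r \<longrightarrow> f x \<in> T r \<and> f x \<in> A x \<and> f x \<noteq> x)"
      using bag_invD(3,6)[OF inv R_less] f by simp
    have "\<exists>r0. \<forall>r\<in>R. r \<noteq> r0 \<longrightarrow> lam \<le> sum w (T r)" using tops(1) by blast
    then show ?thesis
      unfolding part_inv_def R by (intro conjI bag_invD(8,9)[OF inv] a)
  qed
  show "part_inv (f(u := par v)) (mark(v := 1, u := 1)) (T(v := T v - T u))"
    if heavy: "(c - 1) * lam < sub v" and u: "u \<in> K v"
  proof -
    let ?T = "T(v := T v - T u)"
    note uf = K_facts[OF u]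
    \<comment> \<open>Since \<open>par 0 = 0\<close>, the pointer of \<open>u\<close> is overwritten
      by its old value.\<close>
    have fu: "f(u := par v) = f" using uf assms par_0 by auto
    have R2: "roots 0 (mark(v := 1, u := 1)) = insert u R"
      unfolding R[symmetric] using uf(1) unfolding roots_def by auto
    have vR: "v \<in> R" using R_Suc by auto
    have T_sub: "?T r \<subseteq> T r" for r by auto
    have "disjoint_family_on ?T (insert u R)"
      unfolding disjoint_family_on_def
    proof (intro ballI impI)
      fix r s assume rs: "r \<in> insert u R" "s \<in> insert u R" "r \<noteq> s"
      have *: "T u \<inter> ?T s = {}" if "s \<in> R" for s
        using T_K_subset[OF u] T_disjoint[OF that vR] by (cases "s = v") auto
      have "?T u = T u" using uf(5) by auto
      then show "?T r \<inter> ?T s = {}"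
        using rs *[of s] *[of r] T_disjoint[of r s] T_sub[of r] T_sub[of s] by (cases "r = u"; cases "s = u") auto
    qed
    moreover have "(\<Union>r\<in>insert u R. ?T r) = (\<Union>r\<in>R. T r)"
      using vR T_K_subset[OF u] uf(5) by (auto split: if_splits)
    moreover have "r \<in> ?T r \<and> connected_graph (induced G (?T r)) \<and> sum w (?T r) \<le> (c - 1) * lam \<and>
        (\<forall>x\<in>?T r. x \<noteq> r \<longrightarrow> f x \<in> ?T r \<and> f x \<in> A x \<and> f x \<noteq> x)" if r: "r \<in> insert u R" for r
    proof -
      consider "r = v" | "r = u" | "r \<in> R" "r \<noteq> v" "r \<noteq> u" using r by auto
      then show ?thesis
      proof cases
        case 1
        then show ?thesis
          using bag_invD(3)[OF inv v_less] v_notin_T[OF u] connected_T_diff[OF u] sum_T_diff[OF u]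
            heavy_split[OF heavy u] f_in_diff[OF u] f[OF vR] by auto
      next
        case 2
        have "x \<in> T v \<and> x \<noteq> v" if "x \<in> T u" for x
          using that T_K_subset[OF u] v_notin_T[OF u] by auto
        moreover have "sum w (T u) \<le> (c - 1) * lam"
          using bag_invD(7)[OF inv uf(1)] uf(7) c1 by linarith
        ultimately show ?thesis
          using 2 bag_invD(3,6)[OF inv uf(1)] uf(5) f_in_kid[OF u] f[OF vR] by auto
      next
        case 3
        then show ?thesis using bag_invD(3,6)[OF inv R_less[OF 3(1)]] f[OF 3(1)] tops[OF 3(1,2)] by auto
      qed
    qed
    moreover have "lam \<le> sum w (?T r)" if "r \<in> insert u R" "r \<noteq> u" for r
      using that tops[of r] heavy_split[OF heavy u] sum_T_diff[OF u] by auto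
    ultimately show ?thesis
      unfolding part_inv_def R2 fu bag_invD(9)[OF inv] by (intro conjI exI[of _ u]) auto
  qed
qed

end

section \<open>Labels and the approximation guarantee\<close>

lemma sum_prefix_mono: "u \<le> v \<Longrightarrow> (\<Sum>x<u. f x) \<le> (\<Sum>x<v. f x)"
  for u v :: nat and f :: "nat \<Rightarrow> nat"
  by (intro sum_mono2) auto

lemma nth_concat_map:
  assumes "v < n" "j < length (f v)"
  shows "(\<Sum>u<v. length (f u)) + j < length (concat (map f [0..<n]))"
    "concat (map f [0..<n]) ! ((\<Sum>u<v. length (f u)) + j) = f v ! j"
proof -
  have len: "length (concat (map f [0..<m])) = (\<Sum>u<m. length (f u))" for m
    by (induction m) auto
  have "(\<Sum>u<v. length (f u)) + j < (\<Sum>u<Suc v. length (f u))" using assms(2) by simp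
  also have "\<dots> \<le> (\<Sum>u<m. length (f u))" if "v < m" for m
    using that by (intro sum_prefix_mono) simp
  finally have less: "(\<Sum>u<v. length (f u)) + j < (\<Sum>u<m. length (f u))" if "v < m" for m
    using that .
  then show "(\<Sum>u<v. length (f u)) + j < length (concat (map f [0..<n]))"
    using assms len by simp
  show "concat (map f [0..<n]) ! ((\<Sum>u<v. length (f u)) + j) = f v ! j"
    using assms(1)
  proof (induction n)
    case (Suc n)
    show ?case
    proof (cases "v < n")
      case True
      then show ?thesis using Suc.IH less[OF True] len[of n] by (simp add: nth_append)
    next
      case False
      then have "v = n" using Suc.prems by simp
      then show ?thesis using len[of n] by (simp add: nth_append)
    qed
  qed simp
qed

section \<open>Lower bound on the optimum\<close>

context bcp_instance
begin

definition offs :: "nat \<Rightarrow> nat" where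
  "offs v = (\<Sum>u<v. deg u)"

lemma offs_Suc: "offs (Suc v) = offs v + deg v"
  by (simp add: offs_def)

lemma offs_mono: "u \<le> v \<Longrightarrow> offs u \<le> offs v"
  unfolding offs_def by (rule sum_prefix_mono)

lemma offs_le: "offs n \<le> 2 * card (edges G)"
  unfolding offs_def by (rule sum_deg_le)

text \<open>Every single vertex lies in some part, and \<open>k\<close> parts of weight at most
  \<open>X\<close> exhaust \<open>total\<close>; the quotient may be rounded up because
  \<open>X\<close> is an integer.\<close>

lemma lam_le_optimum:
  assumes "min_max_bcp_optimum G w k X"
  shows "lam \<le> X"
proof -
  obtain P where P: "partition_on {..<n} P" "card P = k" "heaviest w P = X"
    using assms V unfolding min_max_bcp_optimum_def connected_k_partition_def connected_partition_def by auto
  have fin: "finite P" using P(2) k_pos card.infinite by fastforce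
  have le: "sum w S \<le> X" if "S \<in> P" for S
    using that fin P(3) unfolding heaviest_def by auto
  have U: "\<Union>P = {..<n}" using P(1) by (simp add: partition_on_def)
  have finS: "finite S" if "S \<in> P" for S
    using that U by (metis Union_upper finite_lessThan finite_subset)
  have "w v \<le> X" if v: "v < n" for v
  proof -
    obtain S where "S \<in> P" "v \<in> S" using U v by blast
    then show ?thesis using le[of S] member_le_sum[of v S w] finS by fastforce
  qed
  then have 1: "Max (w ` {..<n}) \<le> X" using n_pos by (subst Max_le_iff) auto
  have "total = sum w (\<Union>P)" unfolding total_def U ..
  also have "\<dots> = (\<Sum>S\<in>P. sum w S)"
    using P(1) finS by (subst sum.Union_disjoint) (auto simp: partition_on_def disjoint_def)
  also have "\<dots> \<le> k * X" using sum_bounded_above[of P "sum w" X] le P(2) by simp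
  finally have "total + k - 1 < Suc X * k" using k_pos by (simp add: algebra_simps)
  then have "(total + k - 1) div k < Suc X" by (rule less_mult_imp_div_less)
  then show ?thesis using 1 unfolding lam_def by simp
qed

text \<open>Keeps \<open>lam\<close> and products with it within the word bound.\<close>

lemma lam_le_total: "lam \<le> total"
proof -
  have "w v \<le> total" if "v < n" for v
    unfolding total_def using that by (intro member_le_sum) auto
  then have 1: "Max (w ` {..<n}) \<le> total" using n_pos by (subst Max_le_iff) auto
  have "w 0 \<le> total" "w 0 \<ge> 1"
    using n_pos w_pos \<open>\<And>v. v < n \<Longrightarrow> w v \<le> total\<close> by auto
  then have "1 \<le> total" by linarith
  then have "(k - 1) * 1 \<le> (k - 1) * total" by (intro mult_le_mono2)
  then have "total + (k - 1) < Suc total * k"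
    using k_pos by (cases k) (auto simp: algebra_simps)
  then have "(total + k - 1) div k < Suc total"
    using k_pos by (intro less_mult_imp_div_less) simp
  then show ?thesis using 1 unfolding lam_def by simp
qed

end

context dfs_tree
begin

lemma finite_roots: "finite (roots 0 mark)"
  unfolding roots_def by simp

lemma part_invD:
  assumes I: "part_inv f mark T" and r: "r \<in> roots 0 mark"
  shows "r < n" "r \<in> T r" "T r \<subseteq> {..<n}" "connected_graph (induced G (T r))"
    "sum w (T r) \<le> (c - 1) * lam" "finite (T r)"
    and "\<And>u. u \<in> T r \<Longrightarrow> u \<noteq> r \<Longrightarrow> f u \<in> T r \<and> f u \<in> A u \<and> f u \<noteq> u"
    and "\<And>s x. s \<in> roots 0 mark \<Longrightarrow> x \<in> T r \<Longrightarrow> x \<in> T s \<Longrightarrow> r = s"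
proof -
  show "r < n" using r unfolding roots_def by auto
  show "r \<in> T r" "connected_graph (induced G (T r))" "sum w (T r) \<le> (c - 1) * lam"
    and "\<And>u. u \<in> T r \<Longrightarrow> u \<noteq> r \<Longrightarrow> f u \<in> T r \<and> f u \<in> A u \<and> f u \<noteq> u"
    using I r unfolding part_inv_def by simp_all
  show sub: "T r \<subseteq> {..<n}" using I r unfolding part_inv_def by blast
  then show "finite (T r)" using finite_subset by blast
  show "r = s" if "s \<in> roots 0 mark" "x \<in> T r" "x \<in> T s" for s x
    using I r that unfolding part_inv_def disjoint_family_on_def by blast
qed

lemma part_inv_approximation:
  assumes I: "part_inv f mark T"
  shows "min_max_bcp_approximation (c - 1) G w k (T ` roots 0 mark)"
proof -
  let ?R = "roots 0 mark"
  note D = part_invD[OF I]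
  have cover: "(\<Union>r\<in>?R. T r) = {..<n}" using I unfolding part_inv_def by blast
  have "partition_on {..<n} (T ` ?R)"
    using cover D(2,8) unfolding partition_on_def disjoint_def by blast
  then have conn: "connected_partition G (T ` ?R)"
    using V D(4) unfolding connected_partition_def by auto
  obtain r0 where r0: "\<And>r. r \<in> ?R \<Longrightarrow> r \<noteq> r0 \<Longrightarrow> lam \<le> sum w (T r)"
    using I unfolding part_inv_def by blast
  have "?R \<noteq> {}" using cover n_pos by auto
  \<comment> \<open>The light root if there is one, and any root otherwise; all roots except
    \<open>r1\<close> thus weigh at least \<open>lam\<close>.\<close>
  then obtain r1 where r1: "r1 \<in> ?R" "r0 \<in> ?R \<Longrightarrow> r1 = r0" by blast
  have "w r1 \<le> sum w (T r1)" using member_le_sum[of r1 "T r1" w] D(2,6)[OF r1(1)] by simp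
  then have "1 \<le> sum w (T r1)" using w_pos D(1)[OF r1(1)] by fastforce
  moreover have "card (?R - {r1}) * lam \<le> (\<Sum>r\<in>?R - {r1}. sum w (T r))"
    using sum_bounded_below[of "?R - {r1}" lam "\<lambda>r. sum w (T r)"] r0 r1 by auto
  moreover have "total = (\<Sum>r\<in>?R. sum w (T r))"
    unfolding total_def cover[symmetric] using finite_roots D(6,8)
    by (intro sum.UNION_disjoint) blast+
  then have "total = sum w (T r1) + (\<Sum>r\<in>?R - {r1}. sum w (T r))"
    using sum.remove[OF finite_roots r1(1)] by simp
  ultimately have "card (?R - {r1}) * lam < k * lam" using total_le by linarith
  then have "card (?R - {r1}) < k" by simp
  then have "card ?R \<le> k" using r1(1) finite_roots by simp
  then have card: "card (T ` ?R) \<le> k" using card_image_le[OF finite_roots] le_trans by blast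
  have "heaviest w (T ` ?R) \<le> (c - 1) * lam"
    unfolding heaviest_def using \<open>?R \<noteq> {}\<close> finite_roots D(5) by (subst Max_le_iff) auto
  then have "heaviest w (T ` ?R) \<le> (c - 1) * X" if "min_max_bcp_optimum G w k X" for X
    using lam_le_optimum[OF that] by (meson le_trans mult_le_mono2)
  then show ?thesis
    using conn card unfolding min_max_bcp_approximation_def by blast
qed

definition label_inv :: "nat \<Rightarrow> (nat \<Rightarrow> nat) \<Rightarrow> (nat \<Rightarrow> nat set) \<Rightarrow> (nat \<Rightarrow> nat) \<Rightarrow> bool" where
  "label_inv i mark T part \<longleftrightarrow>
     (\<forall>r\<in>roots 0 mark. \<forall>x\<in>T r. x \<in> ord ` {..<i} \<longrightarrow> part x = r)"

text \<open>The pointer leads to a proper ancestor in the same part; it was discovered earlier and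
  therefore already carries its label.\<close>

lemma root_of_unmarked:
  assumes I: "part_inv f mark T" and L: "label_inv i mark T part"
    and i: "i < n" "mark (ord i) = 0"
  shows "\<exists>r\<in>roots 0 mark. ord i \<in> T r \<and> part (f (ord i)) = r \<and> f (ord i) < n \<and> f (ord i) \<noteq> ord i"
proof -
  have "ord i \<in> (\<Union>r\<in>roots 0 mark. T r)" using I ord_less[OF i(1)] unfolding part_inv_def by auto
  then obtain r where r: "r \<in> roots 0 mark" "ord i \<in> T r" by blast
  have "ord i \<noteq> r" using r(1) i(2) unfolding roots_def by auto
  then have f: "f (ord i) \<in> T r" "f (ord i) \<in> A (ord i)" "f (ord i) \<noteq> ord i"
    using part_invD(7)[OF I r(1) r(2)] by auto
  obtain j where "j \<le> i" "f (ord i) = ord j" using A_ord[OF i(1) f(2)] by blast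
  moreover from this have "j \<noteq> i" using f(3) by auto
  ultimately have "f (ord i) \<in> ord ` {..<i}" by auto
  then have "part (f (ord i)) = r" using L r(1) f(1) unfolding label_inv_def by blast
  moreover have "f (ord i) < n" using part_invD(3)[OF I r(1)] f(1) by auto
  ultimately show ?thesis using r f(3) by blast
qed

lemma label_step:
  assumes I: "part_inv f mark T" and L: "label_inv i mark T part" and i: "i < n"
  shows "label_inv (Suc i) mark T
    (part(ord i := if mark (ord i) = 0 then part (f (ord i)) else ord i))"
  unfolding label_inv_def
proof (intro ballI impI)
  fix r x assume r: "r \<in> roots 0 mark" "x \<in> T r" "x \<in> ord ` {..<Suc i}"
  show "(part(ord i := if mark (ord i) = 0 then part (f (ord i)) else ord i)) x = r"
  proof (cases "x = ord i")
    case True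
    show ?thesis
    proof (cases "mark (ord i) = 0")
      case False
      then have "ord i \<in> roots 0 mark" using ord_less[OF i] unfolding roots_def by simp
      then have "ord i = r"
        using part_invD(8)[OF I \<open>ord i \<in> roots 0 mark\<close> r(1), of x] part_invD(2)[OF I \<open>ord i \<in> roots 0 mark\<close>]
          r(2) True by auto
      then show ?thesis using True False by simp
    next
      case mark: True
      obtain r' where "r' \<in> roots 0 mark" "ord i \<in> T r'" "part (f (ord i)) = r'"
        using root_of_unmarked[OF I L i mark] by blast
      then show ?thesis using part_invD(8)[OF I r(1), of r' x] r(2) True mark by auto
    qed
  next
    case False
    then have "x \<in> ord ` {..<i}" using r(3) by (auto simp: less_Suc_eq)
    then show ?thesis using L r False unfolding label_inv_def by auto
  qed
qed

lemma label_inv_output: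
  assumes I: "part_inv f mark T" and L: "label_inv n mark T (arrs s ''part'')"
  shows "output_partition n s = T ` roots 0 mark"
proof -
  have cover: "(\<Union>r\<in>roots 0 mark. T r) = {..<n}" using I unfolding part_inv_def by blast
  have lab: "arrs s ''part'' x = r" if "r \<in> roots 0 mark" "x \<in> T r" for r x
    using L that part_invD(3)[OF I that(1)] unfolding label_inv_def onto by blast
  have eq: "{u. u < n \<and> arrs s ''part'' u = r} = T r" if r: "r \<in> roots 0 mark" for r
  proof
    show "{u. u < n \<and> arrs s ''part'' u = r} \<subseteq> T r"
    proof
      fix u assume "u \<in> {u. u < n \<and> arrs s ''part'' u = r}"
      moreover from this obtain r' where "r' \<in> roots 0 mark" "u \<in> T r'" using cover by blast
      ultimately show "u \<in> T r" using lab by auto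
    qed
    show "T r \<subseteq> {u. u < n \<and> arrs s ''part'' u = r}"
      using lab[OF r] part_invD(3)[OF I r] by auto
  qed
  have "output_partition n s = (\<lambda>r. {u. u < n \<and> arrs s ''part'' u = r}) ` arrs s ''part'' ` {..<n}"
    unfolding output_partition_def by (simp add: image_image)
  also have "arrs s ''part'' ` {..<n} = roots 0 mark"
  proof
    show "arrs s ''part'' ` {..<n} \<subseteq> roots 0 mark"
      using cover lab by (auto simp: set_eq_iff)
    show "roots 0 mark \<subseteq> arrs s ''part'' ` {..<n}"
    proof
      fix r assume r: "r \<in> roots 0 mark"
      show "r \<in> arrs s ''part'' ` {..<n}"
        using lab[OF r part_invD(2)[OF I r]] part_invD(1)[OF I r] by (intro image_eqI[of _ _ r]) auto
    qed
  qed
  finally show ?thesis using eq by simp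
qed

text \<open>Bounds all scans of the cutting pass, since a vertex scans at most the list of its tree
  parent, and does so once. Siblings in the tree are incomparable, hence nonadjacent, so a vertex
  has fewer than \<open>c\<close> tree children.\<close>

lemma sum_deg_par_le: "(\<Sum>j<n. deg (par (ord j))) \<le> c * offs n"
proof -
  have kids: "card {v. v < n \<and> par v = p} \<le> c" if p: "p < n" for p
  proof -
    let ?K = "{v. v < n \<and> v \<noteq> 0 \<and> par v = p}"
    have "card ?K < c"
    proof (rule claw_free_card[OF simple claw])
      show "{p, x} \<in> edges G" if "x \<in> ?K" for x
        using that par_facts(2)[of x] unfolding adj_def by auto
      show "{x, y} \<notin> edges G" if "x \<in> ?K" "y \<in> ?K" for x y
      proof
        assume "{x, y} \<in> edges G"
        then have "adj x y" by (simp add: adj_def)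
        moreover from this have "x \<noteq> y" using adj_irrefl by auto
        ultimately show False
          using A_edge[of x y] that par_facts(3,4)[of x] par_facts(3,4)[of y] by auto
      qed
      show "p \<in> verts G" using p V by simp
    qed
    \<comment> \<open>Vertex \<open>0\<close> counts as its own child because
      \<open>par 0 = 0\<close>; this raises the bound from \<open>c - 1\<close> to
      \<open>c\<close>.\<close>
    moreover have "{v. v < n \<and> par v = p} \<subseteq> insert 0 ?K" by auto
    then have "card {v. v < n \<and> par v = p} \<le> Suc (card ?K)"
      using card_mono[of "insert 0 ?K" "{v. v < n \<and> par v = p}"] by simp
    ultimately show ?thesis by linarith
  qed
  have par_less: "par v < n" if "v < n" for v
    using par_facts(1)[OF that] par_0 n_pos by (cases "v = 0") auto
  have "(\<Sum>j<n. deg (par (ord j))) = (\<Sum>v<n. deg (par v))"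
    using sum.reindex[of ord "{..<n}" "\<lambda>v. deg (par v)"] tree_invD(2)[OF tree] onto by simp
  also have "\<dots> = (\<Sum>p<n. \<Sum>v\<in>{v \<in> {..<n}. par v = p}. deg (par v))"
    using par_less by (subst sum.group) auto
  also have "\<dots> = (\<Sum>p<n. card {v. v < n \<and> par v = p} * deg p)"
    by (intro sum.cong) auto
  also have "\<dots> \<le> (\<Sum>p<n. c * deg p)"
    using kids by (intro sum_mono mult_le_mono1) auto
  finally show ?thesis by (simp add: offs_def sum_distrib_left)
qed

end

section \<open>The program\<close>

definition prepare :: com where
  "prepare =
    Seq (While (Less (Var ''i'') (Var ''n''))
      (Seq (Assign ''W'' (Add (Var ''W'') (Get ''weight'' (Var ''i''))))
      (Seq (If (Less (Var ''L'') (Get ''weight'' (Var ''i''))) (Assign ''L'' (Get ''weight'' (Var ''i''))) Skip)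
      (Seq (Put ''sub'' (Var ''i'') (Get ''weight'' (Var ''i'')))
           (Assign ''i'' (Add (Var ''i'') (Const 1)))))))
    (Seq (Assign ''h'' (Div (Add (Var ''W'') (Sub (Var ''k'') (Const 1))) (Var ''k'')))
    (Seq (If (Less (Var ''L'') (Var ''h'')) (Assign ''L'' (Var ''h'')) Skip)
    (Seq (Put ''vis'' (Const 0) (Const 1))
    (Seq (Assign ''cnt'' (Const 1))
         (Assign ''go'' (Const 1))))))"

definition search_body :: com where
  "search_body =
    If (Less (Add (Get ''off'' (Var ''cur'')) (Get ''ptr'' (Var ''cur'')))
         (Get ''off'' (Add (Var ''cur'') (Const 1))))
      (Seq (Assign ''u'' (Get ''adj'' (Add (Get ''off'' (Var ''cur'')) (Get ''ptr'' (Var ''cur'')))))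
      (Seq (Put ''ptr'' (Var ''cur'') (Add (Get ''ptr'' (Var ''cur'')) (Const 1)))
           (If (Equal (Get ''vis'' (Var ''u'')) (Const 0))
             (Seq (Put ''vis'' (Var ''u'') (Const 1))
             (Seq (Put ''par'' (Var ''u'') (Var ''cur''))
             (Seq (Put ''ord'' (Var ''cnt'') (Var ''u''))
             (Seq (Assign ''cnt'' (Add (Var ''cnt'') (Const 1)))
                  (Assign ''cur'' (Var ''u''))))))
             Skip)))
      (If (Equal (Var ''cur'') (Const 0))
        (Assign ''go'' (Const 0))
        (Assign ''cur'' (Get ''par'' (Var ''cur''))))"

text \<open>There is no early exit: \<open>x\<close> ends up as the last suitable kid in the list,
  and any suitable kid will do.\<close>

definition scan_body :: com where
  "scan_body =
    Seq (Assign ''y'' (Get ''adj'' (Var ''j'')))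
    (Seq (If (And (Equal (Get ''par'' (Var ''y'')) (Var ''v'')) (Equal (Get ''mark'' (Var ''y'')) (Const 0)))
           (Assign ''x'' (Var ''y'')) Skip)
         (Assign ''j'' (Add (Var ''j'') (Const 1))))"

definition scan :: com where
  "scan = While (Less (Var ''j'') (Get ''off'' (Add (Var ''p'') (Const 1)))) scan_body"

definition detach :: com where
  "detach =
    Seq scan
    (Seq (Put ''par'' (Var ''x'') (Var ''p''))
    (Seq (Put ''sub'' (Var ''v'') (Sub (Get ''sub'' (Var ''v'')) (Get ''sub'' (Var ''x''))))
         (If (Equal (Var ''v'') (Const 0))
           (Put ''mark'' (Var ''x'') (Const 1))
           (Put ''sub'' (Var ''p'') (Add (Get ''sub'' (Var ''p'')) (Get ''sub'' (Var ''x'')))))))"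

text \<open>The array \<open>par\<close> first holds the search parents and then serves as the map
  \<open>f\<close>. The entry of an unprocessed vertex is still the original one, so
  \<open>p\<close> is the tree parent of \<open>v\<close>.\<close>

definition bag_body :: "nat \<Rightarrow> com" where
  "bag_body c =
    Seq (Assign ''i'' (Sub (Var ''i'') (Const 1)))
    (Seq (Assign ''v'' (Get ''ord'' (Var ''i'')))
    (Seq (Assign ''p'' (Get ''par'' (Var ''v'')))
         (If (Less (Get ''sub'' (Var ''v'')) (Var ''L''))
           (If (Equal (Var ''v'') (Const 0))
             (Put ''mark'' (Var ''v'') (Const 1))
             (Put ''sub'' (Var ''p'') (Add (Get ''sub'' (Var ''p'')) (Get ''sub'' (Var ''v'')))))
           (Seq (Put ''mark'' (Var ''v'') (Const 1))
                (If (Less (Mul (Const (c - 1)) (Var ''L'')) (Get ''sub'' (Var ''v'')))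
                  (Seq (Assign ''j'' (Get ''off'' (Var ''p'')))
                       detach)
                  Skip)))))"

definition label_body :: com where
  "label_body =
    Seq (Assign ''v'' (Get ''ord'' (Var ''i'')))
    (Seq (If (Equal (Get ''mark'' (Var ''v'')) (Const 0))
           (Put ''part'' (Var ''v'') (Get ''part'' (Get ''par'' (Var ''v''))))
           (Put ''part'' (Var ''v'') (Var ''v'')))
         (Assign ''i'' (Add (Var ''i'') (Const 1))))"

definition program :: "nat \<Rightarrow> com" where
  "program c =
    Seq prepare
    (Seq (While (Less (Const 0) (Var ''go'')) search_body)
    (Seq (Assign ''i'' (Var ''n''))
    (Seq (While (Less (Const 0) (Var ''i'')) (bag_body c))
         (While (Less (Var ''i'') (Var ''n'')) label_body))))"

text \<open>The bounds cover the largest numbers formed: vertex indices, positions in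
  \<open>adj\<close>, the numerator \<open>total + k - 1\<close> of the rounded quotient, and
  \<open>(c - 1) * lam\<close>.\<close>

locale bcp_ram = bcp_instance +
  fixes B :: nat
  assumes B_n: "Suc n < B" and B_offs: "Suc (offs n) < B" and B_total: "total + k < B"
    and B_c: "c * Suc total < B"
begin

definition base :: "state \<Rightarrow> bool" where
  "base s \<longleftrightarrow> vars s ''n'' = n \<and> vars s ''k'' = k \<and> (\<forall>v\<le>n. arrs s ''off'' v = offs v) \<and>
     (\<forall>v<n. \<forall>j<deg v. arrs s ''adj'' (offs v + j) = nbrs v ! j)"

lemma offs_less: "v \<le> n \<Longrightarrow> Suc (offs v) < B"
  using offs_mono[of v n] B_offs by simp

lemma sum_w_le: "S \<subseteq> {..<n} \<Longrightarrow> sum w S \<le> total"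
  unfolding total_def by (intro sum_mono2) auto

text \<open>Inserting \<open>0\<close> gives the empty prefix the value \<open>0\<close>, the
  initial content of \<open>L\<close>.\<close>

definition max_w :: "nat \<Rightarrow> nat" where
  "max_w i = Max (insert 0 (w ` {..<i}))"

lemma max_w_0: "max_w 0 = 0"
  by (simp add: max_w_def)

lemma max_w_Suc: "max_w (Suc i) = max (w i) (max_w i)"
proof -
  have "insert 0 (w ` {..<Suc i}) = insert (w i) (insert 0 (w ` {..<i}))"
    by (auto simp: lessThan_Suc)
  then show ?thesis unfolding max_w_def by (simp only:) (subst Max_insert, auto)
qed

lemma max_w_le: "max_w i \<le> sum w {..<i}"
  by (induction i) (auto simp: max_w_0 max_w_Suc)

lemma max_w_n: "max_w n = Max (w ` {..<n})"
  unfolding max_w_def using n_pos by (subst Max_insert) auto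

text \<open>\<open>N\<close> is the budget of the loop, and \<open>40\<close> a generous bound for
  one iteration. The numerical factors in the later budgets arise in the same way.\<close>

definition prepare_st :: "nat \<Rightarrow> state \<Rightarrow> bool" where
  "prepare_st N s \<longleftrightarrow> base s \<and> (\<forall>v<n. arrs s ''weight'' v = w v) \<and> vars s ''cur'' = 0 \<and>
     (\<forall>a\<in>{''vis'', ''par'', ''ord'', ''ptr'', ''mark''}. arrs s a = (\<lambda>_. 0)) \<and>
     vars s ''i'' \<le> n \<and> vars s ''W'' = sum w {..<vars s ''i''} \<and>
     vars s ''L'' = max_w (vars s ''i'') \<and>
     (\<forall>v<vars s ''i''. arrs s ''sub'' v = w v) \<and> N = 40 * (n - vars s ''i'')"

definition prepared :: "state \<Rightarrow> bool" where
  "prepared s \<longleftrightarrow> base s \<and> vars s ''L'' = lam \<and> (\<forall>v<n. arrs s ''sub'' v = w v) \<and>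
     arrs s ''mark'' = (\<lambda>_. 0)"

lemma run_prepare:
  assumes "prepare_st N s"
  shows "run B prepare s (\<lambda>t s'. t \<le> N + 100 \<and> prepared s' \<and> vars s' ''cur'' = 0 \<and>
    vars s' ''cnt'' = 1 \<and> vars s' ''go'' = 1 \<and> arrs s' ''vis'' = (\<lambda>_. 0)(0 := 1) \<and>
    arrs s' ''par'' = (\<lambda>_. 0) \<and> arrs s' ''ord'' = (\<lambda>_. 0) \<and> arrs s' ''ptr'' = (\<lambda>_. 0))"
  unfolding prepare_def
proof (rule run_Seq, rule run_mono[OF run_While[of prepare_st, OF assms]])
  show "bfits B (Less (Var ''i'') (Var ''n'')) s" if "prepare_st N s" for N s
    using that B_n unfolding prepare_st_def base_def by simp
next
  fix N s assume I: "prepare_st N s" and b: "bval (Less (Var ''i'') (Var ''n'')) s"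
  let ?i = "vars s ''i''"
  have i: "?i < n" using b I unfolding prepare_st_def base_def by simp
  have wi: "arrs s ''weight'' ?i = w ?i" using I i unfolding prepare_st_def by simp
  have "sum w {..<?i} + w ?i = sum w {..<Suc ?i}" by simp
  also have "\<dots> \<le> total" using i by (intro sum_w_le) auto
  finally have W: "sum w {..<?i} + w ?i < B" using B_total by simp
  have L: "max_w ?i < B"
    using max_w_le[of ?i] W by simp
  show "run B (Seq (Assign ''W'' (Add (Var ''W'') (Get ''weight'' (Var ''i''))))
      (Seq (If (Less (Var ''L'') (Get ''weight'' (Var ''i''))) (Assign ''L'' (Get ''weight'' (Var ''i''))) Skip)
      (Seq (Put ''sub'' (Var ''i'') (Get ''weight'' (Var ''i'')))
           (Assign ''i'' (Add (Var ''i'') (Const 1)))))) s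
    (\<lambda>t s'. \<exists>N'. prepare_st N' s' \<and> 1 + bcost (Less (Var ''i'') (Var ''n'')) + t + N' \<le> N)"
    using I i W L wi B_n max_w_Suc[of ?i] unfolding prepare_st_def base_def
    by (intro wp_run) (auto simp: less_Suc_eq max_def Let_def)
next
  fix t s' assume "t \<le> N + 1 + bcost (Less (Var ''i'') (Var ''n'')) \<and>
    \<not> bval (Less (Var ''i'') (Var ''n'')) s' \<and> (\<exists>N'. prepare_st N' s')"
  then obtain N' where t: "t \<le> N + 4" and I: "prepare_st N' s'" and "\<not> vars s' ''i'' < vars s' ''n''"
    by auto
  then have i: "vars s' ''i'' = n" "vars s' ''n'' = n" unfolding prepare_st_def base_def by auto
  have L: "lam = max (vars s' ''L'') ((total + (k - 1)) div k)"
    using I i k_pos max_w_n unfolding prepare_st_def lam_def by simp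
  have "lam \<le> total" by (rule lam_le_total)
  then have "vars s' ''L'' < B" "(total + (k - 1)) div k < B" "total + (k - 1) < B"
    using L B_total by auto
  moreover have "total = sum w {..<n}" by (simp add: total_def)
  ultimately show "run B (Seq (Assign ''h'' (Div (Add (Var ''W'') (Sub (Var ''k'') (Const 1))) (Var ''k'')))
    (Seq (If (Less (Var ''L'') (Var ''h'')) (Assign ''L'' (Var ''h'')) Skip)
    (Seq (Put ''vis'' (Const 0) (Const 1))
    (Seq (Assign ''cnt'' (Const 1))
         (Assign ''go'' (Const 1)))))) s'
    (\<lambda>t' s'. 1 + t + t' \<le> N + 100 \<and> prepared s' \<and> vars s' ''cur'' = 0 \<and>
    vars s' ''cnt'' = 1 \<and> vars s' ''go'' = 1 \<and> arrs s' ''vis'' = (\<lambda>_. 0)(0 := 1) \<and>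
    arrs s' ''par'' = (\<lambda>_. 0) \<and> arrs s' ''ord'' = (\<lambda>_. 0) \<and> arrs s' ''ptr'' = (\<lambda>_. 0))"
    using I i L t B_total B_n unfolding prepare_st_def prepared_def base_def
    by (intro wp_run) (auto simp: max_def)
qed

text \<open>The bracket in the budget is a potential that drops in every iteration. A skipped
  neighbour uses up a list entry and a retreat lowers the depth \<open>card (A cur)\<close>; a
  discovery raises the depth by one, which the factor \<open>2\<close> on the undiscovered vertices
  more than repays. The final test is paid by the depth \<open>1\<close> of the root.\<close>

definition search_abs :: "nat \<Rightarrow> nat \<Rightarrow> nat \<Rightarrow> (nat \<Rightarrow> nat) \<Rightarrow> (nat \<Rightarrow> nat) \<Rightarrow> (nat \<Rightarrow> nat) \<Rightarrow>
    (nat \<Rightarrow> nat) \<Rightarrow> nat \<Rightarrow> (nat \<Rightarrow> nat set) \<Rightarrow> bool" where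
  "search_abs N go cur ptr vis par ord m A \<longleftrightarrow>
     tree_inv par ord m A \<and> vis = (\<lambda>v. if v \<in> ord ` {..<m} then 1 else 0) \<and>
     (if go = 0 then ord ` {..<n} = {..<n} \<and> m = n
      else go = 1 \<and> search_inv cur ptr ord m A \<and>
        N = 100 * ((\<Sum>v<n. deg v - ptr v) + 2 * (n - m) + card (A cur)))"

definition search_st :: "nat \<Rightarrow> state \<Rightarrow> bool" where
  "search_st N s \<longleftrightarrow> prepared s \<and>
     (\<exists>A. search_abs N (vars s ''go'') (vars s ''cur'') (arrs s ''ptr'') (arrs s ''vis'')
        (arrs s ''par'') (arrs s ''ord'') (vars s ''cnt'') A)"

lemma sum_rest:
  assumes "cur < n" "ptr cur < deg cur"
  shows "Suc (\<Sum>v<n. deg v - (ptr(cur := Suc (ptr cur))) v) = (\<Sum>v<n. deg v - ptr v)"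
proof -
  have "(\<Sum>v\<in>{..<n} - {cur}. deg v - (ptr(cur := Suc (ptr cur))) v) = (\<Sum>v\<in>{..<n} - {cur}. deg v - ptr v)"
    by (intro sum.cong) auto
  then show ?thesis
    using assms sum.remove[of "{..<n}" cur "\<lambda>v. deg v - ptr v"]
      sum.remove[of "{..<n}" cur "\<lambda>v. deg v - (ptr(cur := Suc (ptr cur))) v"] by simp
qed

lemma search_abs_discover:
  assumes I: "search_abs N 1 cur ptr vis par ord m A"
    and u: "ptr cur < deg cur" "u = nbrs cur ! ptr cur" "vis u = 0"
  shows "\<exists>N' A'. search_abs N' 1 u (ptr(cur := Suc (ptr cur))) (vis(u := 1)) (par(u := cur)) (ord(m := u)) (Suc m) A' \<and>
    N' + 100 \<le> N"
proof -
  have T: "tree_inv par ord m A" and S: "search_inv cur ptr ord m A" and un: "u \<notin> ord ` {..<m}"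
    and vis: "vis = (\<lambda>v. if v \<in> ord ` {..<m} then 1 else 0)"
    using I u unfolding search_abs_def by (auto split: if_splits)
  have cur: "cur \<in> ord ` {..<m}" using S unfolding search_inv_def by simp
  then have cn: "cur < n" using tree_invD(3)[OF T] by auto
  have adj: "adj cur u" using nth_nbrs_adj[OF cn u(1)] u(2) by simp
  let ?A = "A(u := insert u (A cur))"
  have T': "tree_inv (par(u := cur)) (ord(m := u)) (Suc m) ?A"
    by (rule tree_inv_discover[OF T S un adj])
  have "card (?A u) \<le> Suc (card (A cur))" by (simp add: card_insert_le_m1)
  moreover have "Suc m \<le> n" using tree_inv_le[OF T'] .
  moreover have "(\<lambda>v. if v \<in> (ord(m := u)) ` {..<Suc m} then 1 else 0) = vis(u := 1)"
    unfolding vis by (rule ext) (auto simp: lessThan_Suc)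
  ultimately show ?thesis
    using T' search_inv_discover[OF T S un u(2,1)] sum_rest[of cur ptr, OF cn u(1)] I
    unfolding search_abs_def by (intro exI[of _ ?A] exI) auto
qed

lemma search_abs_skip:
  assumes I: "search_abs N 1 cur ptr vis par ord m A"
    and u: "ptr cur < deg cur" "vis (nbrs cur ! ptr cur) \<noteq> 0"
  shows "\<exists>N' A'. search_abs N' 1 cur (ptr(cur := Suc (ptr cur))) vis par ord m A' \<and> N' + 100 \<le> N"
proof -
  have T: "tree_inv par ord m A" and S: "search_inv cur ptr ord m A"
    and un: "nbrs cur ! ptr cur \<in> ord ` {..<m}"
    using I u unfolding search_abs_def by (auto split: if_splits)
  have "cur < n" using S tree_invD(3)[OF T] unfolding search_inv_def by auto
  then show ?thesis
    using search_inv_skip[OF T S un u(1)] sum_rest[of cur ptr, OF _ u(1)] I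
    unfolding search_abs_def by (intro exI[of _ A] exI) auto
qed

lemma search_abs_retreat:
  assumes I: "search_abs N 1 cur ptr vis par ord m A"
    and u: "\<not> ptr cur < deg cur" "cur \<noteq> 0"
  shows "\<exists>N' A'. search_abs N' 1 (par cur) ptr vis par ord m A' \<and> N' + 100 \<le> N"
proof -
  have T: "tree_inv par ord m A" and S: "search_inv cur ptr ord m A"
    using I u unfolding search_abs_def by (auto split: if_splits)
  have cur: "cur \<in> ord ` {..<m}" using S unfolding search_inv_def by simp
  then have "cur < n" using tree_invD(3)[OF T] by auto
  then have p: "ptr cur = deg cur" using S u(1) unfolding search_inv_def by (meson le_neq_implies_less)
  have "finite (A (par cur))"
    using tree_inv_subset[OF T tree_inv_par(1)[OF T cur u(2)]] finite_subset by blast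
  then have "card (A cur) = Suc (card (A (par cur)))"
    using tree_inv_par(3,4)[OF T cur u(2)] by simp
  then show ?thesis
    using search_inv_retreat[OF T S p u(2)] I
    unfolding search_abs_def by (intro exI[of _ A] exI) auto
qed

lemma search_abs_finish:
  assumes I: "search_abs N 1 0 ptr vis par ord m A" and u: "\<not> ptr 0 < deg 0"
  shows "search_abs 0 0 0 ptr vis par ord m A \<and> 100 \<le> N"
proof -
  have T: "tree_inv par ord m A" and S: "search_inv 0 ptr ord m A"
    using I u unfolding search_abs_def by (auto split: if_splits)
  have "ptr 0 = deg 0" using S u(1) n_pos unfolding search_inv_def by (meson le_neq_implies_less)
  then show ?thesis
    using search_inv_finish[OF T S] I tree_invD(6)[OF T]
    unfolding search_abs_def by auto
qed

lemma search_abs_bounds: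
  assumes I: "search_abs N 1 cur ptr vis par ord m A"
  shows "cur < n" "ptr cur \<le> deg cur" "m \<le> n" "par cur < n" "vis v \<le> 1"
    "ptr cur < deg cur \<Longrightarrow> nbrs cur ! ptr cur < n"
proof -
  have T: "tree_inv par ord m A" and S: "search_inv cur ptr ord m A"
    using I unfolding search_abs_def by (auto split: if_splits)
  have cur: "cur \<in> ord ` {..<m}" using S unfolding search_inv_def by simp
  then show cn: "cur < n" using tree_invD(3)[OF T] by auto
  then show "ptr cur \<le> deg cur" using S unfolding search_inv_def by simp
  show "m \<le> n" by (rule tree_inv_le[OF T])
  show "par cur < n"
    using tree_inv_par(1)[OF T cur] tree_invD(3,5)[OF T] n_pos by (cases "cur = 0") auto
  show "vis v \<le> 1" using I unfolding search_abs_def by auto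
  show "ptr cur < deg cur \<Longrightarrow> nbrs cur ! ptr cur < n"
    using nth_nbrs_adj[OF cn] adj_less by blast
qed

text \<open>The summand \<open>4\<close> is the cost of the loop test.\<close>

lemma run_search_body:
  assumes I: "search_st N s" and go: "0 < vars s ''go''"
  shows "run B search_body s (\<lambda>t s'. \<exists>N'. search_st N' s' \<and> 4 + t + N' \<le> N)"
proof -
  let ?cur = "vars s ''cur''" and ?ptr = "arrs s ''ptr''" and ?vis = "arrs s ''vis''"
  let ?par = "arrs s ''par''" and ?ord = "arrs s ''ord''" and ?m = "vars s ''cnt''"
  obtain A where A0: "search_abs N (vars s ''go'') ?cur ?ptr ?vis ?par ?ord ?m A"
    using I unfolding search_st_def by blast
  then have g1: "vars s ''go'' = 1" using go unfolding search_abs_def by (auto split: if_splits)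
  have A: "search_abs N 1 ?cur ?ptr ?vis ?par ?ord ?m A" using A0 g1 by simp
  note b = search_abs_bounds[OF A]
  have P: "prepared s" using I unfolding search_st_def by blast
  have off: "arrs s ''off'' ?cur = offs ?cur" "arrs s ''off'' (Suc ?cur) = offs ?cur + deg ?cur"
    using P b(1) offs_Suc unfolding prepared_def base_def by auto
  have adj: "arrs s ''adj'' (offs ?cur + ?ptr ?cur) = nbrs ?cur ! ?ptr ?cur" if "?ptr ?cur < deg ?cur"
    using P b(1) that unfolding prepared_def base_def by auto
  have B1: "Suc (offs ?cur + deg ?cur) < B" using offs_less[of "Suc ?cur"] b(1) offs_Suc by simp
  have vis: "?vis v < B" for v using b(5)[of v] B_n n_pos by linarith
  have lt: "x < B" "Suc x < B" if "x \<le> n" for x using that B_n by auto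
  note F = off B1 vis lt b(1-4) g1 P
  show ?thesis
  proof (cases "?ptr ?cur < deg ?cur")
    case True
    let ?u = "nbrs ?cur ! ?ptr ?cur"
    show ?thesis
    proof (cases "?vis ?u = 0")
      case new: True
      obtain N' A' where "search_abs N' 1 ?u (?ptr(?cur := Suc (?ptr ?cur))) (?vis(?u := 1))
          (?par(?u := ?cur)) (?ord(?m := ?u)) (Suc ?m) A'" "N' + 100 \<le> N"
        using search_abs_discover[OF A True refl new] by blast
      then show ?thesis
        using F True new adj[OF True] b(6)[OF True] unfolding search_body_def
        by (intro wp_run) (auto simp: search_st_def prepared_def base_def intro!: exI[of _ N'] exI[of _ A'])
    next
      case old: False
      obtain N' A' where "search_abs N' 1 ?cur (?ptr(?cur := Suc (?ptr ?cur))) ?vis ?par ?ord ?m A'"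
          "N' + 100 \<le> N"
        using search_abs_skip[OF A True old] by blast
      then show ?thesis
        using F True old adj[OF True] b(6)[OF True] unfolding search_body_def
        by (intro wp_run) (auto simp: search_st_def prepared_def base_def intro!: exI[of _ N'] exI[of _ A'])
    qed
  next
    case False
    show ?thesis
    proof (cases "?cur = 0")
      case True
      then have "search_abs 0 0 ?cur ?ptr ?vis ?par ?ord ?m A" "100 \<le> N"
        using search_abs_finish[of N ?ptr ?vis ?par ?ord ?m A] A False by auto
      then show ?thesis
        using F True False unfolding search_body_def
        by (intro wp_run) (auto simp: search_st_def prepared_def base_def intro!: exI[of _ 0] exI[of _ A])
    next
      case cur: False
      obtain N' A' where "search_abs N' 1 (?par ?cur) ?ptr ?vis ?par ?ord ?m A'" "N' + 100 \<le> N"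
        using search_abs_retreat[OF A False cur] by blast
      then show ?thesis
        using F cur False unfolding search_body_def
        by (intro wp_run) (auto simp: search_st_def prepared_def base_def intro!: exI[of _ N'] exI[of _ A'])
    qed
  qed
qed

lemma run_search:
  assumes "search_st N s"
  shows "run B (While (Less (Const 0) (Var ''go'')) search_body) s
    (\<lambda>t s'. t \<le> N + 4 \<and> prepared s' \<and> arrs s' ''ord'' ` {..<n} = {..<n} \<and>
      (\<exists>A. tree_inv (arrs s' ''par'') (arrs s' ''ord'') n A))"
proof (rule run_mono[OF run_While[of search_st, OF assms]])
  fix N s assume I: "search_st N s"
  then have "vars s ''go'' \<le> 1" unfolding search_st_def search_abs_def by (auto split: if_splits)
  then show "bfits B (Less (Const 0) (Var ''go'')) s" using B_n n_pos by auto
  show "run B search_body s (\<lambda>t s'. \<exists>N'. search_st N' s' \<and> 1 + bcost (Less (Const 0) (Var ''go'')) + t + N' \<le> N)"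
    if "bval (Less (Const 0) (Var ''go'')) s"
    by (rule run_mono[OF run_search_body[OF I]]) (use that in auto)
next
  fix t s' assume "t \<le> N + 1 + bcost (Less (Const 0) (Var ''go'')) \<and>
    \<not> bval (Less (Const 0) (Var ''go'')) s' \<and> (\<exists>N'. search_st N' s')"
  then obtain N' A where "t \<le> N + 4" "prepared s'" "vars s' ''cnt'' = n" "arrs s' ''ord'' ` {..<n} = {..<n}"
    "tree_inv (arrs s' ''par'') (arrs s' ''ord'') (vars s' ''cnt'') A"
    unfolding search_st_def search_abs_def by auto
  then show "t \<le> N + 4 \<and> prepared s' \<and> arrs s' ''ord'' ` {..<n} = {..<n} \<and>
      (\<exists>A. tree_inv (arrs s' ''par'') (arrs s' ''ord'') n A)"
    by metis
qed

end

section \<open>Scanning the adjacency list of the parent\<close>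

context bcp_ram
begin

definition found :: "state \<Rightarrow> nat \<Rightarrow> bool" where
  "found s x \<longleftrightarrow> adj (vars s ''p'') x \<and> arrs s ''par'' x = vars s ''v'' \<and> arrs s ''mark'' x = 0"

text \<open>Until the first match \<open>x\<close> holds a leftover value, hence the implication.
  Its premise is met at the end, when the whole list of \<open>p\<close> has been read.\<close>

definition scan_st :: "state \<Rightarrow> nat \<Rightarrow> state \<Rightarrow> bool" where
  "scan_st s N s' \<longleftrightarrow> arrs s' = arrs s \<and>
     (\<forall>z. z \<notin> {''j'', ''x'', ''y''} \<longrightarrow> vars s' z = vars s z) \<and>
     offs (vars s ''p'') \<le> vars s' ''j'' \<and> vars s' ''j'' \<le> offs (Suc (vars s ''p'')) \<and>
     N = 40 * (offs (Suc (vars s ''p'')) - vars s' ''j'') \<and>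
     ((\<exists>l<vars s' ''j'' - offs (vars s ''p''). found s (nbrs (vars s ''p'') ! l)) \<longrightarrow> found s (vars s' ''x''))"

lemma run_scan:
  assumes "base s" "vars s ''p'' < n" "vars s ''v'' < n" "vars s ''j'' = offs (vars s ''p'')"
    and small: "\<And>y. y < n \<Longrightarrow> arrs s ''par'' y < n \<and> arrs s ''mark'' y \<le> 1"
    and ex: "\<exists>y. found s y"
  shows "run B scan s (\<lambda>t s'. t \<le> 40 * deg (vars s ''p'') + 40 \<and> arrs s' = arrs s \<and>
    (\<forall>z. z \<notin> {''j'', ''x'', ''y''} \<longrightarrow> vars s' z = vars s z) \<and> found s (vars s' ''x''))"
proof -
  let ?p = "vars s ''p''"
  let ?b = "Less (Var ''j'') (Get ''off'' (Add (Var ''p'') (Const 1)))"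
  have off: "arrs s ''off'' (Suc ?p) = offs (Suc ?p)"
    using assms(1,2) unfolding base_def by simp
  have B1: "Suc (offs (Suc ?p)) < B" using offs_less assms(2) by simp
  have lt: "x < B" "Suc x < B" if "x \<le> n" for x using that B_n by auto
  have "scan_st s (40 * deg ?p) s"
    using assms offs_Suc unfolding scan_st_def by auto
  then have "run B scan s (\<lambda>t s'. t \<le> 40 * deg ?p + 1 + bcost ?b \<and> \<not> bval ?b s' \<and> (\<exists>N'. scan_st s N' s'))"
    unfolding scan_def
  proof (rule run_While)
    show "bfits B ?b s'" if "scan_st s N s'" for N s'
      using that B1 off assms(2) lt unfolding scan_st_def by auto
    fix N s' assume I: "scan_st s N s'" and b: "bval ?b s'"
    let ?j = "vars s' ''j''" and ?l = "vars s' ''j'' - offs ?p"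
    have j: "?j < offs (Suc ?p)" using b off I unfolding scan_st_def by simp
    have l: "?l < deg ?p" "?j = offs ?p + ?l"
    proof -
      have "offs ?p \<le> ?j" using I unfolding scan_st_def by simp
      then show "?l < deg ?p" "?j = offs ?p + ?l" using j offs_Suc[of ?p] by linarith+
    qed
    define y where "y = nbrs ?p ! ?l"
    have y: "arrs s ''adj'' ?j = y"
      using assms(1,2) l unfolding base_def y_def by metis
    have adj: "adj ?p y" using nth_nbrs_adj[OF assms(2) l(1)] unfolding y_def .
    then have yn: "y < n" using adj_less by blast
    have small': "arrs s ''par'' y < B" "arrs s ''mark'' y < B" "vars s ''v'' < B"
      using small[OF yn] lt assms(3) B_n n_pos by auto
    have ex_Suc: "(\<exists>l<Suc ?j - offs ?p. found s (nbrs ?p ! l)) \<longleftrightarrow>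
        (\<exists>l<?j - offs ?p. found s (nbrs ?p ! l)) \<or> found s y"
      using I unfolding scan_st_def y_def by (auto simp: Suc_diff_le less_Suc_eq)
    show "run B scan_body s' (\<lambda>t s''. \<exists>N'. scan_st s N' s'' \<and> 1 + bcost ?b + t + N' \<le> N)"
    proof (cases "found s y")
      case True
      then have "arrs s ''par'' y = vars s ''v''" "arrs s ''mark'' y = 0" unfolding found_def by auto
      then show ?thesis
        using I y j B1 lt yn small' ex_Suc True unfolding scan_body_def
        by (intro wp_run) (auto simp: scan_st_def)
    next
      case False
      then have "\<not> (arrs s ''par'' y = vars s ''v'' \<and> arrs s ''mark'' y = 0)"
        using adj unfolding found_def by auto
      then show ?thesis
        using I y j B1 lt yn small' ex_Suc False unfolding scan_body_def
        by (intro wp_run) (auto simp: scan_st_def)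
    qed
  qed
  then show ?thesis
  proof (rule run_mono)
    fix t s' assume "t \<le> 40 * deg ?p + 1 + bcost ?b \<and> \<not> bval ?b s' \<and> (\<exists>N'. scan_st s N' s')"
    then obtain N' where t: "t \<le> 40 * deg ?p + 40" and I: "scan_st s N' s'" and "\<not> bval ?b s'" by auto
    then have j: "vars s' ''j'' = offs ?p + deg ?p"
      using off offs_Suc[of ?p] unfolding scan_st_def by simp
    obtain y where y: "found s y" using ex by blast
    then have "y \<in> set (nbrs ?p)" using set_nbrs[OF assms(2)] unfolding found_def by auto
    then obtain l where "l < deg ?p" "nbrs ?p ! l = y" by (auto simp: in_set_conv_nth deg_def)
    then have "found s (vars s' ''x'')" using I y j unfolding scan_st_def by auto
    then show "t \<le> 40 * deg ?p + 40 \<and> arrs s' = arrs s \<and>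
        (\<forall>z. z \<notin> {''j'', ''x'', ''y''} \<longrightarrow> vars s' z = vars s z) \<and> found s (vars s' ''x'')"
      using t I unfolding scan_st_def by blast
  qed
qed

end

section \<open>Cutting and labelling on the word RAM\<close>

locale dfs_ram = bcp_ram + dfs_tree
begin

lemma bag_inv_sub_le: "bag_inv i f sub mark T \<Longrightarrow> v < n \<Longrightarrow> sub v \<le> total"
  using bag_invD(4,7)[of i f sub mark T v] sum_w_le[of "T v"] by auto

text \<open>The invariant changes at \<open>i = 0\<close> because \<open>bag_inv\<close> would force
  every marked part to weigh at least \<open>lam\<close>, while the root may leave a light one. The
  bounds on \<open>mark\<close> and \<open>f\<close> keep all reads within the word bound.\<close>

definition bag_abs :: "nat \<Rightarrow> (nat \<Rightarrow> nat) \<Rightarrow> (nat \<Rightarrow> nat) \<Rightarrow> (nat \<Rightarrow> nat) \<Rightarrow> bool" where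
  "bag_abs i f sub mark \<longleftrightarrow> i \<le> n \<and> (\<forall>v. mark v \<le> 1) \<and> (\<forall>v<n. f v < n) \<and>
     (\<exists>T. if i = 0 then part_inv f mark T else bag_inv i f sub mark T)"

text \<open>The budget refers to the fixed tree parent \<open>par\<close>, not to the changing
  array; both agree on the unprocessed vertices. Each scanned entry costs at most
  \<open>40\<close>.\<close>

definition bag_st :: "nat \<Rightarrow> state \<Rightarrow> bool" where
  "bag_st N s \<longleftrightarrow> base s \<and> vars s ''L'' = lam \<and> arrs s ''ord'' = ord \<and>
     bag_abs (vars s ''i'') (arrs s ''par'') (arrs s ''sub'') (arrs s ''mark'') \<and>
     N = (\<Sum>j<vars s ''i''. 200 + 40 * deg (par (ord j)))"

lemma bag_absI:
  assumes "bag_inv i f sub mark T" "i \<le> n" "\<And>v. mark v \<le> 1" "\<And>v. v < n \<Longrightarrow> f v < n"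
  shows "bag_abs i f sub mark"
  using assms bag_inv_part_inv unfolding bag_abs_def by (auto intro!: exI[of _ T])

lemma run_bag_body:
  assumes I: "bag_st N s" and i_pos: "0 < vars s ''i''"
  shows "run B (bag_body c) s (\<lambda>t s'. \<exists>N'. bag_st N' s' \<and> 4 + t + N' \<le> N)"
proof -
  let ?f = "arrs s ''par''" and ?sub = "arrs s ''sub''" and ?mark = "arrs s ''mark''"
  obtain i where i: "vars s ''i'' = Suc i" using i_pos gr0_implies_Suc by blast
  define v where "v = ord i"
  have base: "base s" and L: "vars s ''L'' = lam" and ord: "arrs s ''ord'' = ord"
    and abs: "bag_abs (Suc i) ?f ?sub ?mark"
    and N: "N = (\<Sum>j<Suc i. 200 + 40 * deg (par (ord j)))"
    using I i unfolding bag_st_def by auto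
  obtain T where T: "bag_inv (Suc i) ?f ?sub ?mark T" and i_less: "i < n"
    and mark1: "\<And>x. ?mark x \<le> 1" and f_less: "\<And>x. x < n \<Longrightarrow> ?f x < n"
    using abs unfolding bag_abs_def by auto
  interpret st: bag_step G n nbrs w k c par ord A i ?f ?sub ?mark T v
    by unfold_locales (use T i_less v_def in auto)
  have v: "v < n" by (rule st.v_less)
  define p where "p = par v"
  have fv: "?f v = p" using st.f_v p_def by simp
  have p: "p < n" using f_less[OF v] fv by simp
  have N_eq: "N = 200 + 40 * deg p + (\<Sum>j<i. 200 + 40 * deg (par (ord j)))"
    using N by (simp add: v_def p_def)
  have lt: "x < B" "Suc x < B" if "x \<le> n" for x using that B_n by auto
  have tB: "x < B" if "x \<le> total" for x using that B_total by simp
  have sub: "?sub x < B" if "x < n" for x using bag_inv_sub_le[OF T that] tB by simp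
  have mark: "?mark x < B" for x using mark1[of x] B_n n_pos by linarith
  have lamB: "lam < B" using lam_le_total tB by simp
  have v0: "v = 0 \<longleftrightarrow> i = 0" using ord_eq_0[OF i_less] v_def by simp
  have oneB: "Suc 0 < B" using B_n n_pos by simp
  have mul: "(c - Suc 0) * lam < B" "c - Suc 0 < B"
  proof -
    have "(c - Suc 0) * lam \<le> c * Suc total" using lam_le_total by (intro mult_le_mono) auto
    then show "(c - Suc 0) * lam < B" using B_c by simp
    have "c - Suc 0 \<le> c * Suc total" by simp
    then show "c - Suc 0 < B" using B_c by linarith
  qed
  note F = base L ord i N_eq v p fv sub mark lt lamB oneB i_less mul v_def[symmetric]
  show ?thesis
  proof (cases "?sub v < lam")
    case light: True
    show ?thesis
    proof (cases "v = 0")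
      case True
      have "bag_abs i ?f ?sub (?mark(v := 1))"
        unfolding bag_abs_def using st.root_step(1)[OF True light] True v0 mark1 f_less by auto
      then show ?thesis
        using F True light unfolding bag_body_def
        by (intro wp_run) (auto simp: bag_st_def base_def)
    next
      case False
      have B': "bag_inv i ?f (?sub(p := ?sub p + ?sub v)) ?mark (T(p := T p \<union> T v))"
        using st.light_step[OF light False] unfolding p_def .
      then have "bag_abs i ?f (?sub(p := ?sub p + ?sub v)) ?mark"
        using mark1 f_less i_less by (intro bag_absI) auto
      moreover have "?sub p + ?sub v < B" using bag_inv_sub_le[OF B' p] tB by simp
      ultimately show ?thesis
        using F False light unfolding bag_body_def
        by (intro wp_run) (auto simp: bag_st_def base_def)
    qed
  next
    case not_light: False
    show ?thesis
    proof (cases "(c - 1) * lam < ?sub v")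
      case False
      have "bag_inv i ?f ?sub (?mark(v := 1)) T"
        using st.full_step not_light False by simp
      then have "bag_abs i ?f ?sub (?mark(v := 1))"
        using mark1 f_less i_less by (intro bag_absI) auto
      then show ?thesis
        using F False not_light unfolding bag_body_def
        by (intro wp_run) (auto simp: bag_st_def base_def)
    next
      case heavy: True
      \<comment> \<open>The state in which \<open>detach\<close> starts: \<open>v\<close> is already
        marked, and the scan position is at the list of \<open>p\<close>.\<close>
      define s1 where "s1 = s\<lparr>arrs := (arrs s)(''mark'' := ?mark(v := 1)),
        vars := (vars s)(''i'' := i, ''v'' := v, ''p'' := p, ''j'' := offs p)\<rparr>"
      have found: "found s1 x \<longleftrightarrow> x \<in> st.K v \<and> adj p x" for x
      proof
        assume "found s1 x"
        then show "x \<in> st.K v \<and> adj p x"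
          using st.kid_iff[of x] adj_less[of p x] unfolding found_def s1_def by simp
      next
        assume x: "x \<in> st.K v \<and> adj p x"
        then have "?mark x = 0" using st.K_facts(1,2)[of x v] unfolding roots_def by auto
        then show "found s1 x"
          using x st.K_facts(3,5)[of x v] unfolding found_def s1_def by simp
      qed
      obtain u0 where "found s1 u0"
        using st.ex_heavy_kid[OF heavy] found p_def by auto
      then have scan: "run B scan s1 (\<lambda>t s'. t \<le> 40 * deg p + 40 \<and> arrs s' = arrs s1 \<and>
        (\<forall>z. z \<notin> {''j'', ''x'', ''y''} \<longrightarrow> vars s' z = vars s1 z) \<and> found s1 (vars s' ''x''))"
      proof -
        have s1: "base s1" "vars s1 ''p'' = p" "vars s1 ''v'' = v" "vars s1 ''j'' = offs p"
          "\<And>y. y < n \<Longrightarrow> arrs s1 ''par'' y < n \<and> arrs s1 ''mark'' y \<le> 1"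
          using base f_less mark1 unfolding s1_def base_def by auto
        show ?thesis
          using run_scan[OF s1(1), unfolded s1(2-4), OF p v refl s1(5)] \<open>found s1 u0\<close> by blast
      qed
      have offp: "arrs s ''off'' p = offs p" "offs p < B"
        using base p offs_less[of p] unfolding base_def by auto
      \<comment> \<open>The \<open>80\<close> pays for the loop test and for everything in the
        iteration before \<open>detach\<close>.\<close>
      have "run B detach s1 (\<lambda>t s'. \<exists>N'. bag_st N' s' \<and> 80 + t + N' \<le> N)"
        unfolding detach_def
      proof (rule run_Seq, rule run_mono[OF scan])
        fix t and s' :: state assume A: "t \<le> 40 * deg p + 40 \<and> arrs s' = arrs s1 \<and>
          (\<forall>z. z \<notin> {''j'', ''x'', ''y''} \<longrightarrow> vars s' z = vars s1 z) \<and> found s1 (vars s' ''x'')"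
        define u where "u = vars s' ''x''"
        have u: "u \<in> st.K v" "adj p u" "u < n" using A found st.K_facts(1) unfolding u_def by auto
        have uv: "u \<noteq> v" using st.K_facts(5)[OF u(1)] by simp
        show "run B (Seq (Put ''par'' (Var ''x'') (Var ''p''))
                  (Seq (Put ''sub'' (Var ''v'') (Sub (Get ''sub'' (Var ''v'')) (Get ''sub'' (Var ''x''))))
                       (If (Equal (Var ''v'') (Const 0))
                         (Put ''mark'' (Var ''x'') (Const 1))
                         (Put ''sub'' (Var ''p'') (Add (Get ''sub'' (Var ''p'')) (Get ''sub'' (Var ''x'')))))))
            s' (\<lambda>t' s'. \<exists>N'. bag_st N' s' \<and> 80 + (1 + t + t') + N' \<le> N)"
        proof (cases "v = 0")
          case True
          have "bag_abs i (?f(u := p)) (?sub(v := ?sub v - ?sub u)) (?mark(v := 1, u := 1))"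
            unfolding bag_abs_def using st.root_step(2)[OF True heavy u(1)] True v0 mark1 f_less p p_def by auto
          then show ?thesis
            using F A True u uv u_def[symmetric] less_imp_diff_less[OF sub[OF v], of "?sub u"] unfolding s1_def
            by (intro wp_run) (auto simp: bag_st_def base_def)
        next
          case False
          have B': "bag_inv i (?f(u := p)) (?sub(v := ?sub v - ?sub u, p := ?sub p + ?sub u)) (?mark(v := 1))
              (T(v := T v - T u, p := T p \<union> T u))"
            using st.heavy_step[OF heavy False u(1)] u(2) unfolding p_def by simp
          then have "bag_abs i (?f(u := p)) (?sub(v := ?sub v - ?sub u, p := ?sub p + ?sub u)) (?mark(v := 1))"
            using mark1 f_less i_less p by (intro bag_absI) auto
          moreover have "?sub p + ?sub u < B" using bag_inv_sub_le[OF B' p] tB by simp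
          moreover have "p \<noteq> v" using par_facts(6)[OF v False] p_def by simp
          ultimately show ?thesis
            using F A False u uv u_def[symmetric] less_imp_diff_less[OF sub[OF v], of "?sub u"] unfolding s1_def
            by (intro wp_run) (auto simp: bag_st_def base_def)
        qed
      qed
      \<comment> \<open>Symbolic execution of the code before \<open>detach\<close> leaves a
        \<open>wp\<close> goal for \<open>detach\<close> in exactly the state
        \<open>s1\<close>.\<close>
      note R = run_wp[OF this]
      show ?thesis
        using F not_light heavy offp unfolding bag_body_def
        by (intro wp_run) (simp add: base_def, rule wp_mono[OF R[unfolded s1_def One_nat_def]], auto)
    qed
  qed
qed

lemma run_bags:
  assumes "bag_st N s"
  shows "run B (While (Less (Const 0) (Var ''i'')) (bag_body c)) s
    (\<lambda>t s'. t \<le> N + 4 \<and> base s' \<and> arrs s' ''ord'' = ord \<and> vars s' ''i'' = 0 \<and>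
      (\<forall>v. arrs s' ''mark'' v \<le> 1) \<and> (\<exists>T. part_inv (arrs s' ''par'') (arrs s' ''mark'') T))"
proof (rule run_mono[OF run_While[of bag_st, OF assms]])
  fix N s assume I: "bag_st N s"
  then have "vars s ''i'' \<le> n" unfolding bag_st_def bag_abs_def by auto
  then show "bfits B (Less (Const 0) (Var ''i'')) s" using B_n by auto
  show "run B (bag_body c) s (\<lambda>t s'. \<exists>N'. bag_st N' s' \<and> 1 + bcost (Less (Const 0) (Var ''i'')) + t + N' \<le> N)"
    if b: "bval (Less (Const 0) (Var ''i'')) s"
    by (rule run_mono[OF run_bag_body[OF I]]) (use b in auto)
next
  fix t and s' :: state assume "t \<le> N + 1 + bcost (Less (Const 0) (Var ''i'')) \<and>
    \<not> bval (Less (Const 0) (Var ''i'')) s' \<and> (\<exists>N'. bag_st N' s')"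
  then show "t \<le> N + 4 \<and> base s' \<and> arrs s' ''ord'' = ord \<and> vars s' ''i'' = 0 \<and>
      (\<forall>v. arrs s' ''mark'' v \<le> 1) \<and> (\<exists>T. part_inv (arrs s' ''par'') (arrs s' ''mark'') T)"
    unfolding bag_st_def bag_abs_def by auto
qed

definition label_st :: "(nat \<Rightarrow> nat set) \<Rightarrow> (nat \<Rightarrow> nat) \<Rightarrow> (nat \<Rightarrow> nat) \<Rightarrow> nat \<Rightarrow> state \<Rightarrow> bool" where
  "label_st T f mark N s \<longleftrightarrow> base s \<and> arrs s ''ord'' = ord \<and> arrs s ''par'' = f \<and> arrs s ''mark'' = mark \<and>
     vars s ''i'' \<le> n \<and> label_inv (vars s ''i'') mark T (arrs s ''part'') \<and> N = 40 * (n - vars s ''i'')"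

lemma run_labels:
  assumes s: "base s" "arrs s ''ord'' = ord" "vars s ''i'' = 0"
    and mark: "\<And>v. arrs s ''mark'' v \<le> 1" and P: "part_inv (arrs s ''par'') (arrs s ''mark'') T"
  shows "run B (While (Less (Var ''i'') (Var ''n'')) label_body) s
    (\<lambda>t s'. t \<le> 40 * n + 4 \<and> min_max_bcp_approximation (c - 1) G w k (output_partition n s'))"
proof -
  let ?f = "arrs s ''par''" and ?mark = "arrs s ''mark''"
  have "label_st T ?f ?mark (40 * n) s"
    using s unfolding label_st_def label_inv_def by simp
  then show ?thesis
  proof (rule run_mono[OF run_While[of "label_st T ?f ?mark"]])
    show "bfits B (Less (Var ''i'') (Var ''n'')) s'" if "label_st T ?f ?mark N s'" for N s'
      using that B_n unfolding label_st_def base_def by auto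
  next
    fix N s' assume I: "label_st T ?f ?mark N s'" and b: "bval (Less (Var ''i'') (Var ''n'')) s'"
    define i where "i = vars s' ''i''"
    have i: "i < n" using I b unfolding label_st_def base_def i_def by simp
    have L: "label_inv i ?mark T (arrs s' ''part'')" using I unfolding label_st_def i_def by simp
    have lt: "x < B" "Suc x < B" if "x \<le> n" for x using that B_n by auto
    have markB: "?mark x < B" for x using mark[of x] B_n n_pos by linarith
    note L' = label_step[OF P L i]
    have st: "base s'" "arrs s' ''ord'' = ord" "arrs s' ''par'' = ?f" "arrs s' ''mark'' = ?mark"
      "vars s' ''i'' = i" "N = 40 * (n - i)"
      using I unfolding label_st_def i_def by auto
    have oneB: "Suc 0 < B" using B_n n_pos by simp
    have in_less: "ord i < n" by (rule ord_less[OF i])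
    show "run B label_body s' (\<lambda>t s''. \<exists>N'. label_st T ?f ?mark N' s'' \<and>
        1 + bcost (Less (Var ''i'') (Var ''n'')) + t + N' \<le> N)"
    proof (cases "?mark (ord i) = 0")
      case True
      obtain r where "r \<in> roots 0 ?mark" "arrs s' ''part'' (?f (ord i)) = r" "?f (ord i) < n"
        using root_of_unmarked[OF P L i True] by blast
      moreover from this have "r < n" using part_invD(1)[OF P] by simp
      ultimately show ?thesis
        using st i lt markB L' oneB in_less True unfolding label_body_def
        by (intro wp_run) (simp add: label_st_def base_def)
    next
      case False
      then show ?thesis
        using st i lt markB L' oneB in_less unfolding label_body_def
        by (intro wp_run) (simp add: label_st_def base_def)
    qed
  next
    fix t and s' :: state assume "t \<le> 40 * n + 1 + bcost (Less (Var ''i'') (Var ''n'')) \<and>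
      \<not> bval (Less (Var ''i'') (Var ''n'')) s' \<and> (\<exists>N'. label_st T ?f ?mark N' s')"
    then obtain N' where t: "t \<le> 40 * n + 4" and I: "label_st T ?f ?mark N' s'"
      and "\<not> vars s' ''i'' < vars s' ''n''" by auto
    then have "vars s' ''i'' = n" unfolding label_st_def base_def by simp
    then have "label_inv n ?mark T (arrs s' ''part'')" using I unfolding label_st_def by simp
    then have "output_partition n s' = T ` roots 0 ?mark" by (rule label_inv_output[OF P])
    then show "t \<le> 40 * n + 4 \<and> min_max_bcp_approximation (c - 1) G w k (output_partition n s')"
      using t part_inv_approximation[OF P] by simp
  qed
qed

end

section \<open>Total running time\<close>

context bcp_ram
begin

lemma run_program:
  assumes s: "base s" "\<And>v. v < n \<Longrightarrow> arrs s ''weight'' v = w v"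
    and zero: "\<And>a. a \<in> {''vis'', ''par'', ''ord'', ''ptr'', ''mark''} \<Longrightarrow> arrs s a = (\<lambda>_. 0)"
    and vars: "\<And>x. x \<in> {''i'', ''W'', ''L'', ''cur''} \<Longrightarrow> vars s x = 0"
  shows "run B (program c) s (\<lambda>t s'. t \<le> (80 * c + 700) * card (edges G) + 1000 \<and>
    min_max_bcp_approximation (c - 1) G w k (output_partition n s'))"
proof -
  let ?m = "card (edges G)"
  have "prepare_st (40 * n) s"
    using s zero vars unfolding prepare_st_def by (simp add: max_w_0)
  note prep = run_prepare[OF this]
  show ?thesis
    unfolding program_def
  proof (rule run_Seq, rule run_mono[OF prep])
    fix t1 and s1 :: state
    assume s1: "t1 \<le> 40 * n + 100 \<and> prepared s1 \<and> vars s1 ''cur'' = 0 \<and>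
      vars s1 ''cnt'' = 1 \<and> vars s1 ''go'' = 1 \<and> arrs s1 ''vis'' = (\<lambda>_. 0)(0 := 1) \<and>
      arrs s1 ''par'' = (\<lambda>_. 0) \<and> arrs s1 ''ord'' = (\<lambda>_. 0) \<and> arrs s1 ''ptr'' = (\<lambda>_. 0)"
    have "search_abs (100 * (offs n + 2 * (n - 1) + 1)) 1 0 (\<lambda>_. 0) ((\<lambda>_. 0)(0 := 1)) (\<lambda>_. 0) (\<lambda>_. 0) 1 (\<lambda>_. {0})"
      unfolding search_abs_def offs_def using tree_inv_init search_inv_init by auto
    then have "search_st (100 * (offs n + 2 * (n - 1) + 1)) s1"
      using s1 unfolding search_st_def by auto
    note search = run_search[OF this]
    show "run B (Seq (While (Less (Const 0) (Var ''go'')) search_body)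
        (Seq (Assign ''i'' (Var ''n''))
        (Seq (While (Less (Const 0) (Var ''i'')) (bag_body c))
             (While (Less (Var ''i'') (Var ''n'')) label_body)))) s1
      (\<lambda>t' s'. 1 + t1 + t' \<le> (80 * c + 700) * ?m + 1000 \<and>
        min_max_bcp_approximation (c - 1) G w k (output_partition n s'))"
    proof (rule run_Seq, rule run_mono[OF search])
      fix t2 and s2 :: state
      assume s2: "t2 \<le> 100 * (offs n + 2 * (n - 1) + 1) + 4 \<and> prepared s2 \<and>
        arrs s2 ''ord'' ` {..<n} = {..<n} \<and> (\<exists>A. tree_inv (arrs s2 ''par'') (arrs s2 ''ord'') n A)"
      let ?par = "arrs s2 ''par''" and ?ord = "arrs s2 ''ord''"
      obtain A where A: "tree_inv ?par ?ord n A" using s2 by blast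
      interpret d: dfs_ram G n nbrs w k c B ?par ?ord A
        by unfold_locales (use A s2 in auto)
      define s3 where "s3 = s2\<lparr>vars := (vars s2)(''i'' := n)\<rparr>"
      have s3: "run B (Assign ''i'' (Var ''n'')) s2 (\<lambda>t s'. t = 2 \<and> s' = s3)"
        using s2 B_n unfolding s3_def prepared_def base_def by (intro wp_run) simp
      let ?N = "\<Sum>j<n. 200 + 40 * deg (?par (?ord j))"
      have init: "d.bag_inv n ?par (arrs s2 ''sub'') (\<lambda>_. 0) (\<lambda>v. {v})"
        by (rule d.bag_inv_init) (use s2 in \<open>auto simp: prepared_def\<close>)
      have "?par v < n" if "v < n" for v
        using d.par_facts(1)[OF that] d.par_0 n_pos by (cases "v = 0") auto
      then have "d.bag_st ?N s3"
        using d.bag_absI[OF init] s2 unfolding d.bag_st_def s3_def prepared_def base_def by auto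
      note bags = d.run_bags[OF this]
      have n_le: "n \<le> Suc ?m"
        using card_verts_le[OF A] s2 by simp
      have "?N = 200 * n + 40 * (\<Sum>j<n. deg (?par (?ord j)))"
        by (simp add: sum.distrib sum_distrib_left)
      also have "\<dots> \<le> 200 * n + 40 * (c * (2 * ?m))"
        using d.sum_deg_par_le mult_le_mono2[OF offs_le, of c] by linarith
      finally have N: "?N \<le> 200 * n + 80 * c * ?m" by simp
      show "run B (Seq (Assign ''i'' (Var ''n''))
          (Seq (While (Less (Const 0) (Var ''i'')) (bag_body c))
               (While (Less (Var ''i'') (Var ''n'')) label_body))) s2
        (\<lambda>t' s'. 1 + t1 + (1 + t2 + t') \<le> (80 * c + 700) * ?m + 1000 \<and>
          min_max_bcp_approximation (c - 1) G w k (output_partition n s'))"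
      proof (rule run_Seq, rule run_mono[OF s3], clarify, rule run_Seq, rule run_mono[OF bags])
        fix t4 and s4 :: state
        assume s4: "t4 \<le> ?N + 4 \<and> base s4 \<and> arrs s4 ''ord'' = ?ord \<and> vars s4 ''i'' = 0 \<and>
          (\<forall>v. arrs s4 ''mark'' v \<le> 1) \<and> (\<exists>T. d.part_inv (arrs s4 ''par'') (arrs s4 ''mark'') T)"
        then obtain T where "d.part_inv (arrs s4 ''par'') (arrs s4 ''mark'') T" by blast
        note labels = d.run_labels[OF _ _ _ _ this]
        show "run B (While (Less (Var ''i'') (Var ''n'')) label_body) s4
          (\<lambda>t' s'. 1 + t1 + (1 + t2 + (1 + 2 + (1 + t4 + t'))) \<le> (80 * c + 700) * ?m + 1000 \<and>
            min_max_bcp_approximation (c - 1) G w k (output_partition n s'))"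
        proof (rule run_mono[OF labels])
          fix t5 and s5 :: state
          assume s5: "t5 \<le> 40 * n + 4 \<and> min_max_bcp_approximation (c - 1) G w k (output_partition n s5)"
          \<comment> \<open>The terms in \<open>n\<close> add up to \<open>480 * n\<close>, with
            \<open>n\<close> at most one more than the number of edges. The search adds at most
            \<open>200\<close> per edge through \<open>offs n\<close>, and the scans
            \<open>80 * c\<close> per edge.\<close>
          have "t1 \<le> 40 * n + 100" "t2 \<le> 100 * offs n + 200 * n + 104" "t4 \<le> ?N + 4" "t5 \<le> 40 * n + 4"
            using s1 s2 s4 s5 by auto
          moreover have "(80 * c + 700) * ?m = 80 * c * ?m + 700 * ?m" by (simp add: add_mult_distrib)
          ultimately have "1 + t1 + (1 + t2 + (1 + 2 + (1 + t4 + t5))) \<le> (80 * c + 700) * ?m + 1000"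
            using N n_le offs_le by linarith
          then show "1 + t1 + (1 + t2 + (1 + 2 + (1 + t4 + t5))) \<le> (80 * c + 700) * ?m + 1000 \<and>
            min_max_bcp_approximation (c - 1) G w k (output_partition n s5)"
            using s5 by blast
        qed (use s4 in auto)
      qed
    qed
  qed
qed

end

lemma array_of_nth: "i < length xs \<Longrightarrow> array_of xs i = xs ! i"
  by (simp add: array_of_def)

theorem theorem1:
  fixes c :: nat
  assumes "c \<ge> 3"
  shows "\<exists>(p :: com) (d :: nat) (T :: nat \<Rightarrow> nat).
    (\<lambda>m. real (T m)) \<in> O(\<lambda>m. real m) \<and>
    (\<forall>(G :: nat graph) (w :: nat \<Rightarrow> nat) (k :: nat) (n :: nat) (nbrs :: nat \<Rightarrow> nat list).
       simple_graph G \<and> connected_graph G \<and> claw_free c G \<and>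
       verts G = {..<n} \<and> adjacency_lists G nbrs \<and>
       (\<forall>v\<in>verts G. w v \<ge> 1) \<and> k \<ge> 1 \<longrightarrow>
       (\<exists>t s. exec (magnitude G w k ^ d) p (input_state n nbrs w k) t s \<and>
          t \<le> T (card (edges G)) \<and>
          min_max_bcp_approximation (c - 1) G w k (output_partition n s)))"
proof -
  define T where "T m = (80 * c + 700) * m + 1000" for m
  have "(\<lambda>m. real (T m)) \<in> O(\<lambda>m. real m)"
  proof (rule bigoI[where c = "real (T 1)"], rule eventually_at_top_linorderI[of 1])
    fix m :: nat assume "1 \<le> m"
    \<comment> \<open>For \<open>m >= 1\<close> the additive constant is absorbed into the linear
      term.\<close>
    then have "T m \<le> T 1 * m" unfolding T_def by (simp add: algebra_simps)
    then have "real (T m) \<le> real (T 1) * real m" by (metis of_nat_le_iff of_nat_mult)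
    then show "norm (real (T m)) \<le> real (T 1) * norm (real m)" by simp
  qed
  moreover have "\<exists>t s. exec (magnitude G w k ^ (c + 4)) (program c) (input_state n nbrs w k) t s \<and>
      t \<le> T (card (edges G)) \<and> min_max_bcp_approximation (c - 1) G w k (output_partition n s)"
    if "simple_graph G" "connected_graph G" "claw_free c G" "verts G = {..<n}" "adjacency_lists G nbrs"
      "\<forall>v\<in>verts G. w v \<ge> 1" "k \<ge> 1" for G w k n nbrs
  proof -
    interpret bcp_instance G n nbrs w k c
      by unfold_locales (use that assms in auto)
    define M where "M = magnitude G w k"
    have M: "M = 2 + n + card (edges G) + total + k"
      unfolding M_def magnitude_def total_def V by simp
    have pos: "1 \<le> M" using M by simp
    have pow: "M ^ i \<le> M ^ (c + 4)" if "i \<le> c + 4" for i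
      using power_increasing[OF that pos] .
    \<comment> \<open>The adjacency array may have twice as many cells as there are edges, which
      \<open>M\<close> alone does not bound.\<close>
    have M2: "2 * M \<le> M ^ 2" using M by (simp add: power2_eq_square)
    \<comment> \<open>The instance does not bound \<open>c\<close>, but \<open>c\<close> is fixed
      and may enter the exponent: \<open>M\<close> is at least \<open>2\<close>, so
      \<open>M ^ c\<close> exceeds \<open>c\<close>.\<close>
    have "c < 2 ^ c" by (rule less_exp)
    also have "2 ^ c \<le> M ^ c" using M by (intro power_mono) auto
    finally have "c * M \<le> M ^ c * M" by (intro mult_le_mono1) simp
    then have Mc: "c * M \<le> M ^ Suc c" by (simp add: mult.commute)
    have le: "M \<le> M ^ (c + 4)" "M ^ 2 \<le> M ^ (c + 4)" "M ^ Suc c \<le> M ^ (c + 4)"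
      using pow[of 1] pow[of 2] pow[of "Suc c"] by auto
    interpret bcp_ram G n nbrs w k c "M ^ (c + 4)"
    proof
      show "Suc n < M ^ (c + 4)" "total + k < M ^ (c + 4)" using M le(1) by linarith+
      show "Suc (offs n) < M ^ (c + 4)" using M le(2) M2 offs_le by linarith
      have "c * Suc total < c * M" using M assms by (intro mult_strict_left_mono) auto
      then show "c * Suc total < M ^ (c + 4)" using Mc le(3) by linarith
    qed
    let ?s = "input_state n nbrs w k"
    have "array_of (map (\<lambda>v. \<Sum>u<v. length (nbrs u)) [0..<Suc n]) v = offs v" if "v \<le> n" for v
      using that unfolding offs_def deg_def by (subst array_of_nth) (auto simp del: upt_Suc)
    moreover have "array_of (concat (map nbrs [0..<n])) (offs v + j) = nbrs v ! j"
      if "v < n" "j < deg v" for v j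
      using nth_concat_map[of v n j nbrs] that unfolding offs_def deg_def by (simp add: array_of_nth)
    ultimately have "base ?s" unfolding base_def input_state_def by auto
    moreover have "arrs ?s ''weight'' v = w v" if "v < n" for v
      using that by (simp add: input_state_def array_of_def)
    ultimately have "run (M ^ (c + 4)) (program c) ?s (\<lambda>t s'. t \<le> T (card (edges G)) \<and>
        min_max_bcp_approximation (c - 1) G w k (output_partition n s'))"
      unfolding T_def by (rule run_program) (auto simp: input_state_def)
    then show ?thesis unfolding run_def M_def by blast
  qed
  ultimately show ?thesis by blast
qed

end
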